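(* From a two-state max-plus automaton $B$ over a finite alphabet $\Sigma$ one can effectively construct a one-counter transducer $T_B$ such that, for every word $w\in\Sigma^*$: (i) if $[\![B]\!](w)=-\infty$, then $T_B$ has no successful computation on $w$; (ii) if $[\![B]\!](w)\ne-\infty$, then $T_B$ has a successful computation on $w$, and every successful computation of $T_B$ on $w$ emits exactly $[\![B]\!](w)$. The construction may be chosen deterministic. Each input letter triggers a finite-control routine built from unit counter increments, blocking decrements, zero tests, and fixed integer emissions. Such a routine has a unique finite execution from any reachable configuration (its running length may depend on the counter value).
   Context: $\mathbb{Z}_{\max}=(\mathbb{Z}\cup\{-\infty\},\max,+)$ is the max-plus semiring, with $-\infty$ absorbing for $+$. A two-state max-plus automaton $B$ over a finite alphabet $\Sigma$ consists of an initial row vector $\lambda\in\mathbb{Z}_{\max}^{1\times 2}$, a matrix $M_\sigma\in\mathbb{Z}_{\max}^{2\times2}$ for each $\sigma\in\Sigma$, and a final column vector $\phi\in\mathbb{Z}_{\max}^{2\times1}$. It computes $[\![B]\!]:\Sigma^*\to\mathbb{Z}\cup\{-\infty\}$, $[\![B]\!](\sigma_1\cdots\sigma_n)=\lambda M_{\sigma_1}\cdots M_{\sigma_n}\phi$ (max-plus products; the empty word has value $\lambda\phi$). A one-counter transducer is a finite-control machine with one counter holding a value in $\mathbb{N}$, initially $0$. It has a finite set of control states, an initial state, accepting states, and finitely many transitions. Each transition goes from one control state to another and either reads the next symbol of the input (a letter of $\Sigma$, or the end-of-input marker after the last letter) or is internal (reads nothing). Each transition performs one counter action: no action, increment by $1$,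 decrement by $1$ (blocking: not enabled when the counter is $0$), or a zero test (one branch enabled only if the counter is $0$, the other only if it is positive). Each transition also emits a fixed integer, possibly $0$. A configuration is a control state together with a counter value. A computation on $w$ starts in the initial state with counter $0$; it is successful if it reads all of $w$ and the end-of-input marker and ends in an accepting state. It emits the sum of the integers emitted by its transitions. The routine triggered by a letter is the transition reading that letter together with the internal transitions belonging to its processing before the next input symbol is read; an execution may also end by rejecting. The transducer is deterministic if in every reachable configuration, for the given remaining input, at most one transition is enabled. Effectively construct means that there is an algorithm producing $T_B$ from $B$. *)

theory Defs
  imports "HOL-Analysis.Finite_Cartesian_Product" "HOL-Library.Nat_Bijection"
begin

datatype zmax = NegInf | Fin int

text \<open>The semiring addition is the maximum and the semiring multiplication is the addition of
  integers, so that the library's matrix products over \<^typ>\<open>zmax\<close> are max-plus products.\<close>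

instantiation zmax :: comm_semiring_1
begin

definition zero_zmax :: zmax where "zero_zmax = NegInf"

definition one_zmax :: zmax where "one_zmax = Fin 0"

fun plus_zmax :: "zmax \<Rightarrow> zmax \<Rightarrow> zmax" where
  "plus_zmax NegInf y = y"
| "plus_zmax x NegInf = x"
| "plus_zmax (Fin a) (Fin b) = Fin (max a b)"

fun times_zmax :: "zmax \<Rightarrow> zmax \<Rightarrow> zmax" where
  "times_zmax (Fin a) (Fin b) = Fin (a + b)"
| "times_zmax _ _ = NegInf"

instance
proof
  fix a b c :: zmax
  show "a * b * c = a * (b * c)"
    by (cases a; cases b; cases c) simp_all
  show "a * b = b * a"
    by (cases a; cases b) simp_all
  show "1 * a = a"
    by (cases a) (simp_all add: one_zmax_def)
  show "a + b + c = a + (b + c)"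
    by (cases a; cases b; cases c) simp_all
  show "a + b = b + a"
    by (cases a; cases b) simp_all
  show "0 + a = a"
    by (simp add: zero_zmax_def)
  show "0 * a = 0"
    by (simp add: zero_zmax_def)
  show "a * 0 = 0"
    by (cases a) (simp_all add: zero_zmax_def)
  show "(a + b) * c = a * c + b * c"
    by (cases a; cases b; cases c) simp_all
  show "(0::zmax) \<noteq> 1"
    by (simp add: zero_zmax_def one_zmax_def)
qed

end

text \<open>The alphabet is a separate parameter: only the matrices of its letters are part of the
  automaton, the other values of \<open>mp_mat\<close> are irrelevant.\<close>

record 'a mp_automaton =
  mp_init :: "zmax ^ 2"
  mp_mat :: "'a \<Rightarrow> zmax ^ 2 ^ 2"
  mp_final :: "zmax ^ 2"

definition mp_weight :: "'a mp_automaton \<Rightarrow> 'a list \<Rightarrow> zmax" where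
  "mp_weight B w =
     (\<Sum>i\<in>UNIV. foldl (\<lambda>v \<sigma>. v v* mp_mat B \<sigma>) (mp_init B) w $ i * mp_final B $ i)"

datatype 'a symbol = Letter 'a | EndMarker

text \<open>\<open>IfZero\<close> and \<open>IfPos\<close> are the two branches of a zero test.\<close>

datatype counter_action = NoAction | Inc | Dec | IfZero | IfPos

text \<open>A transition with \<open>reads = None\<close> is internal.\<close>

record 'a transition =
  source :: nat
  reads :: "'a symbol option"
  action :: counter_action
  emits :: int
  target :: nat

record 'a transducer =
  states :: "nat set"
  start :: nat
  accepting :: "nat set"
  transitions :: "'a transition set"

definition one_counter_transducer :: "'a set \<Rightarrow> 'a transducer \<Rightarrow> bool" where
  "one_counter_transducer \<Sigma> T \<longleftrightarrow>
     finite (states T) \<and> start T \<in> states T \<and> accepting T \<subseteq> states T \<and>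
     finite (transitions T) \<and>
     (\<forall>t\<in>transitions T. source t \<in> states T \<and> target t \<in> states T \<and>
        (\<forall>\<sigma>. reads t = Some (Letter \<sigma>) \<longrightarrow> \<sigma> \<in> \<Sigma>))"

text \<open>A configuration is kept together with the remaining input: control state, counter value,
  symbols not yet read.\<close>

type_synonym 'a config = "nat \<times> nat \<times> 'a symbol list"

fun action_enabled :: "counter_action \<Rightarrow> nat \<Rightarrow> bool" where
  "action_enabled NoAction n \<longleftrightarrow> True"
| "action_enabled Inc n \<longleftrightarrow> True"
| "action_enabled Dec n \<longleftrightarrow> n > 0"
| "action_enabled IfZero n \<longleftrightarrow> n = 0"
| "action_enabled IfPos n \<longleftrightarrow> n > 0"

fun action_result :: "counter_action \<Rightarrow> nat \<Rightarrow> nat" where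
  "action_result NoAction n = n"
| "action_result Inc n = n + 1"
| "action_result Dec n = n - 1"
| "action_result IfZero n = n"
| "action_result IfPos n = n"

fun enabled :: "'a transition \<Rightarrow> 'a config \<Rightarrow> bool" where
  "enabled t (q, n, u) \<longleftrightarrow> source t = q \<and> action_enabled (action t) n \<and>
     (case reads t of None \<Rightarrow> True | Some s \<Rightarrow> u \<noteq> [] \<and> hd u = s)"

fun fire :: "'a transition \<Rightarrow> 'a config \<Rightarrow> 'a config" where
  "fire t (q, n, u) = (target t, action_result (action t) n,
     (case reads t of None \<Rightarrow> u | Some s \<Rightarrow> tl u))"

inductive computation ::
  "'a transducer \<Rightarrow> 'a config \<Rightarrow> 'a transition list \<Rightarrow> 'a config \<Rightarrow> bool" for T where
  computation_Nil: "computation T c [] c"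
| computation_Cons: "\<lbrakk>t \<in> transitions T; enabled t c; computation T (fire t c) ts c'\<rbrakk>
    \<Longrightarrow> computation T c (t # ts) c'"

definition start_config :: "'a transducer \<Rightarrow> 'a list \<Rightarrow> 'a config" where
  "start_config T w = (start T, 0, map Letter w @ [EndMarker])"

definition successful :: "'a transducer \<Rightarrow> 'a list \<Rightarrow> 'a transition list \<Rightarrow> bool" where
  "successful T w ts \<longleftrightarrow>
     (\<exists>q n. computation T (start_config T w) ts (q, n, []) \<and> q \<in> accepting T)"

definition emission :: "'a transition list \<Rightarrow> int" where
  "emission ts = sum_list (map emits ts)"

definition reachable :: "'a transducer \<Rightarrow> 'a list \<Rightarrow> 'a config \<Rightarrow> bool" where
  "reachable T w c \<longleftrightarrow> (\<exists>ts. computation T (start_config T w) ts c)"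

definition deterministic :: "'a set \<Rightarrow> 'a transducer \<Rightarrow> bool" where
  "deterministic \<Sigma> T \<longleftrightarrow>
     (\<forall>w\<in>lists \<Sigma>. \<forall>c. reachable T w c \<longrightarrow>
        (\<forall>t\<in>transitions T. \<forall>t'\<in>transitions T. enabled t c \<and> enabled t' c \<longrightarrow> t = t'))"

definition no_internal_enabled :: "'a transducer \<Rightarrow> 'a config \<Rightarrow> bool" where
  "no_internal_enabled T c \<longleftrightarrow> (\<forall>t\<in>transitions T. enabled t c \<longrightarrow> reads t \<noteq> None)"

text \<open>A complete execution of the routine triggered by the next letter: the transition reading
  the letter, followed by internal transitions until none is enabled any more. It is empty if
  the letter is rejected at once.\<close>

definition letter_routine :: "'a transducer \<Rightarrow> 'a config \<Rightarrow> 'a transition list \<Rightarrow> bool" where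
  "letter_routine T c ts \<longleftrightarrow>
     (case ts of
        [] \<Rightarrow> (\<forall>t\<in>transitions T. \<not> enabled t c)
      | t # is \<Rightarrow> (\<exists>\<sigma>. reads t = Some (Letter \<sigma>)) \<and> (\<forall>s\<in>set is. reads s = None) \<and>
          (\<exists>c'. computation T c ts c' \<and> no_internal_enabled T c'))"

text \<open>A routine is triggered in a configuration whose next symbol is a letter and in which no
  internal transition of the preceding processing is still to be executed. For a deterministic
  transducer, a finite complete execution also excludes infinite ones.\<close>

definition unique_finite_routines :: "'a set \<Rightarrow> 'a transducer \<Rightarrow> bool" where
  "unique_finite_routines \<Sigma> T \<longleftrightarrow>
     (\<forall>w\<in>lists \<Sigma>. \<forall>q n \<sigma> u.
        reachable T w (q, n, Letter \<sigma> # u) \<and> no_internal_enabled T (q, n, Letter \<sigma> # u) \<longrightarrow>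
        (\<exists>!ts. letter_routine T (q, n, Letter \<sigma> # u) ts))"

text \<open>The total recursive functions, by Kleene's schemes with minimization of regular functions.
  Arguments are passed as a list; missing arguments count as 0.\<close>

definition arg :: "nat \<Rightarrow> nat list \<Rightarrow> nat" where
  "arg i xs = (if i < length xs then xs ! i else 0)"

inductive total_recursive :: "(nat list \<Rightarrow> nat) \<Rightarrow> bool" where
  tr_zero: "total_recursive (\<lambda>xs. 0)"
| tr_Suc: "total_recursive (\<lambda>xs. Suc (arg 0 xs))"
| tr_proj: "total_recursive (arg i)"
| tr_comp: "\<lbrakk>total_recursive f; \<forall>g\<in>set gs. total_recursive g\<rbrakk>
    \<Longrightarrow> total_recursive (\<lambda>xs. f (map (\<lambda>g. g xs) gs))"
| tr_primrec: "\<lbrakk>total_recursive f; total_recursive g\<rbrakk>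
    \<Longrightarrow> total_recursive
          (\<lambda>xs. rec_nat (f (tl xs)) (\<lambda>n r. g (n # r # tl xs)) (arg 0 xs))"
| tr_mu: "\<lbrakk>total_recursive f; \<forall>xs. \<exists>n. f (n # xs) = 0\<rbrakk>
    \<Longrightarrow> total_recursive (\<lambda>xs. LEAST n. f (n # xs) = 0)"

definition computable :: "(nat \<Rightarrow> nat) \<Rightarrow> bool" where
  "computable f \<longleftrightarrow> (\<exists>g. total_recursive g \<and> (\<forall>n. f n = g [n]))"

text \<open>The parameter \<open>e\<close> numbers the
  letters; if it is injective on the alphabet, then the code of a transducer over that alphabet
  determines the transducer.\<close>

fun zmax_code :: "zmax \<Rightarrow> nat" where
  "zmax_code NegInf = 0"
| "zmax_code (Fin k) = Suc (int_encode k)"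

definition vec_code :: "zmax ^ 2 \<Rightarrow> nat" where
  "vec_code v = list_encode [zmax_code (v $ 1), zmax_code (v $ 2)]"

definition mat_code :: "zmax ^ 2 ^ 2 \<Rightarrow> nat" where
  "mat_code M = list_encode [vec_code (M $ 1), vec_code (M $ 2)]"

definition automaton_code :: "'a set \<Rightarrow> ('a \<Rightarrow> nat) \<Rightarrow> 'a mp_automaton \<Rightarrow> nat" where
  "automaton_code \<Sigma> e B = list_encode
     [vec_code (mp_init B),
      set_encode ((\<lambda>\<sigma>. prod_encode (e \<sigma>, mat_code (mp_mat B \<sigma>))) ` \<Sigma>),
      vec_code (mp_final B)]"

fun reads_code :: "('a \<Rightarrow> nat) \<Rightarrow> 'a symbol option \<Rightarrow> nat" where
  "reads_code e None = 0"
| "reads_code e (Some EndMarker) = 1"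
| "reads_code e (Some (Letter \<sigma>)) = e \<sigma> + 2"

fun action_code :: "counter_action \<Rightarrow> nat" where
  "action_code NoAction = 0"
| "action_code Inc = 1"
| "action_code Dec = 2"
| "action_code IfZero = 3"
| "action_code IfPos = 4"

definition transition_code :: "('a \<Rightarrow> nat) \<Rightarrow> 'a transition \<Rightarrow> nat" where
  "transition_code e t = list_encode
     [source t, reads_code e (reads t), action_code (action t), int_encode (emits t), target t]"

definition transducer_code :: "('a \<Rightarrow> nat) \<Rightarrow> 'a transducer \<Rightarrow> nat" where
  "transducer_code e T = list_encode
     [set_encode (states T), start T, set_encode (accepting T),
      set_encode (transition_code e ` transitions T)]"

end

theory Submission
  imports Defs "HOL-Analysis.Cartesian_Space"
begin

text \<open>The transducer keeps the vector \<open>\<lambda> M\<^sub>1 \<dots> M\<^sub>i\<close> up to an additive constant, which has been emitted: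
  if both coordinates are finite, then the smaller one is emitted, the control state knows which one
  it is, and the counter holds the difference \<open>d\<close>. The next vector has coordinates \<open>max a (c + d)\<close> and
  \<open>max b (c' + d)\<close>. Up to a bound, \<open>d\<close> is determined by decrements and zero tests, and the normal form
  of the result is hard-wired. Beyond the bound, it no longer depends on \<open>d\<close> which terms attain the maxima: either
  exactly one coordinate of the result grows with \<open>d\<close> and the other is a finite constant, so that
  the counter only has to be increased by a constant, or the new difference is constant or
  undefined, and the counter is emptied while the required multiple of \<open>d\<close> is emitted.\<close>

section \<open>Closure properties of computable functions\<close>

text \<open>Emitting a common constant early is sound because max-plus multiplication by a matrix
  commutes with adding a constant to both coordinates; two states leave a single difference, and its
  sign fits into the control. The obstacle is that a maximum compares unknown counter values, while
  a counter can only be inspected by emptying it. A uniform bound exists because codes dominate what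
  they encode: the code \<open>n\<close> of the automaton bounds the code of every entry, so
  \<open>2 * n + 1\<close> exceeds the gap between any two finite entries. Since effectivity means
  total recursiveness on codes, the transitions are computed from matrix codes by arithmetic on
  natural numbers, and the same terms serve the semantics and the proof of computability.
  Determinism and unique routines follow from conditions on the transition table alone: no two
  transitions are ever enabled together, and a rank, with the counter as tie-breaker, decreases
  along internal transitions.\<close>

lemma total_recursive_comp1:
  assumes "total_recursive F" "total_recursive f"
  shows "total_recursive (\<lambda>xs. F [f xs])"
  using tr_comp[of F "[f]"] assms by simp

lemma total_recursive_comp2:
  assumes "total_recursive F" "total_recursive f" "total_recursive g"
  shows "total_recursive (\<lambda>xs. F [f xs, g xs])"
  using tr_comp[of F "[f, g]"] assms by simp

lemma total_recursive_Suc: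
  assumes "total_recursive f"
  shows "total_recursive (\<lambda>xs. Suc (f xs))"
  using total_recursive_comp1[OF tr_Suc assms] by (simp add: arg_def)

text \<open>One parameter \<open>p xs\<close> is enough, since several are later packed into one by
  the pairing function.\<close>

lemma total_recursive_rec_nat:
  assumes "total_recursive f" "total_recursive g" "total_recursive h" "total_recursive p"
  shows "total_recursive (\<lambda>xs. rec_nat (f [p xs]) (\<lambda>n r. g [n, r, p xs]) (h xs))"
  using total_recursive_comp2[OF tr_primrec[OF assms(1,2)] assms(3,4)] by (simp add: arg_def)

lemma total_recursive_const: "total_recursive (\<lambda>xs. c)"
  by (induction c) (auto intro: tr_zero total_recursive_Suc)

lemma total_recursive_plus:
  assumes "total_recursive f" "total_recursive g"
  shows "total_recursive (\<lambda>xs. f xs + g xs)"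
proof -
  have "rec_nat b (\<lambda>_ r. Suc r) a = a + b" for a b by (induction a) auto
  then show ?thesis
    using total_recursive_rec_nat[OF tr_proj[of 0] total_recursive_Suc[OF tr_proj[of 1]] assms]
    by (simp add: arg_def)
qed

lemma computable_iff: "computable f \<longleftrightarrow> total_recursive (\<lambda>xs. f (arg 0 xs))"
proof
  assume "computable f"
  then obtain g where g: "total_recursive g" "\<And>n. f n = g [n]"
    unfolding computable_def by blast
  then show "total_recursive (\<lambda>xs. f (arg 0 xs))"
    using total_recursive_comp1[OF g(1) tr_proj[of 0]] by simp
next
  assume "total_recursive (\<lambda>xs. f (arg 0 xs))"
  then show "computable f"
    unfolding computable_def by (intro exI[of _ "\<lambda>xs. f (arg 0 xs)"]) (simp add: arg_def)
qed

lemma computable_compose: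
  assumes "computable f" "computable g"
  shows "computable (\<lambda>x. f (g x))"
  using total_recursive_comp1[of "\<lambda>xs. f (arg 0 xs)" "\<lambda>xs. g (arg 0 xs)"] assms
  unfolding computable_iff by (simp add: arg_def)

named_theorems computable_intros

lemma computable_id [computable_intros]: "computable (\<lambda>x. x)"
  unfolding computable_iff by (rule tr_proj)

lemma computable_const [computable_intros]: "computable (\<lambda>x. c)"
  unfolding computable_iff by (rule total_recursive_const)

lemma computable_Suc [computable_intros]: "computable f \<Longrightarrow> computable (\<lambda>x. Suc (f x))"
  unfolding computable_iff by (rule total_recursive_Suc)

lemma computable_plus [computable_intros]:
  "computable f \<Longrightarrow> computable g \<Longrightarrow> computable (\<lambda>x. f x + g x)"
  unfolding computable_iff by (rule total_recursive_plus)

lemma total_recursive_computable: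
  assumes "computable F" "total_recursive f"
  shows "total_recursive (\<lambda>xs. F (f xs))"
  using total_recursive_comp1[OF assms(1)[unfolded computable_iff] assms(2)] by (simp add: arg_def)

lemma computable_pred: "computable (\<lambda>x. x - 1)"
proof -
  have "rec_nat 0 (\<lambda>n r. n) a = a - 1" for a by (cases a) auto
  then show ?thesis
    using total_recursive_rec_nat[OF tr_zero tr_proj[of 0] tr_proj[of 0] tr_zero]
    unfolding computable_iff by (simp add: arg_def)
qed

lemma total_recursive_diff:
  assumes "total_recursive f" "total_recursive g"
  shows "total_recursive (\<lambda>xs. f xs - g xs)"
proof -
  have rec: "rec_nat a (\<lambda>n r. r - 1) b = a - b" for a b :: nat by (induction b) auto
  from total_recursive_rec_nat[OF tr_proj[of 0] total_recursive_computable[OF computable_pred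
      tr_proj[of 1]] assms(2,1)]
  show ?thesis using rec by (simp add: arg_def)
qed

lemma computable_diff [computable_intros]:
  "computable f \<Longrightarrow> computable g \<Longrightarrow> computable (\<lambda>x. f x - g x)"
  unfolding computable_iff by (rule total_recursive_diff)

lemma computable_mult [computable_intros]:
  assumes "computable f" "computable g"
  shows "computable (\<lambda>x. f x * g x)"
proof -
  have rec: "rec_nat 0 (\<lambda>n r. r + b) a = a * b" for a b :: nat by (induction a) auto
  from total_recursive_rec_nat[OF tr_zero total_recursive_plus[OF tr_proj[of 1] tr_proj[of 2]]
      assms[unfolded computable_iff]]
  show ?thesis unfolding computable_iff by (simp add: arg_def rec)
qed

section \<open>Decidable predicates and case distinction\<close>

definition decidable :: "(nat \<Rightarrow> bool) \<Rightarrow> bool" where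
  "decidable P \<longleftrightarrow> computable (\<lambda>x. if P x then 1 else 0)"

text \<open>Both branches are evaluated and weighted by the characteristic functions of
  \<open>P\<close> and of its complement.\<close>

lemma computable_if [computable_intros]:
  assumes "decidable P" "computable f" "computable g"
  shows "computable (\<lambda>x. if P x then f x else g x)"
proof -
  have "computable (\<lambda>x. (if P x then 1 else 0) * f x + (1 - (if P x then 1 else 0)) * g x)"
    using assms unfolding decidable_def by (intro computable_intros)
  moreover have "(if P x then 1 else 0) * f x + (1 - (if P x then 1 else 0)) * g x
      = (if P x then f x else g x)" for x by simp
  ultimately show ?thesis by simp
qed

lemma decidable_le [computable_intros]:
  assumes "computable f" "computable g"
  shows "decidable (\<lambda>x. f x \<le> g x)"
proof -
  have "computable (\<lambda>x. 1 - (f x - g x))"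
    using assms by (intro computable_intros)
  moreover have "1 - (f x - g x) = (if f x \<le> g x then 1 else 0)" for x by simp
  ultimately show ?thesis unfolding decidable_def by simp
qed

lemma decidable_not [computable_intros]:
  assumes "decidable P"
  shows "decidable (\<lambda>x. \<not> P x)"
proof -
  have "computable (\<lambda>x. if P x then 0 else 1)"
    using assms by (intro computable_intros)
  moreover have "(if P x then 0 else 1) = (if \<not> P x then 1 else 0 :: nat)" for x by simp
  ultimately show ?thesis unfolding decidable_def by simp
qed

lemma decidable_conj [computable_intros]:
  assumes "decidable P" "decidable Q"
  shows "decidable (\<lambda>x. P x \<and> Q x)"
proof -
  have "computable (\<lambda>x. if P x then if Q x then 1 else 0 else 0)"
    using assms by (intro computable_intros)
  moreover have "(if P x then if Q x then 1 else 0 else 0) = (if P x \<and> Q x then 1 else 0 :: nat)"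
    for x by simp
  ultimately show ?thesis unfolding decidable_def by simp
qed

lemma decidable_disj [computable_intros]:
  assumes "decidable P" "decidable Q"
  shows "decidable (\<lambda>x. P x \<or> Q x)"
  using decidable_not[OF decidable_conj[OF assms[THEN decidable_not]]] by simp

lemma decidable_less [computable_intros]:
  assumes "computable f" "computable g"
  shows "decidable (\<lambda>x. f x < g x)"
  using decidable_not[OF decidable_le[OF assms(2,1)]] by (simp add: not_le)

lemma decidable_eq [computable_intros]:
  assumes "computable f" "computable g"
  shows "decidable (\<lambda>x. f x = g x)"
  using decidable_conj[OF decidable_le[OF assms] decidable_le[OF assms(2,1)]]
  by (simp add: eq_iff)

lemma computable_max [computable_intros]:
  "computable f \<Longrightarrow> computable g \<Longrightarrow> computable (\<lambda>x. max (f x) (g x))"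
  unfolding max_def by (intro computable_intros)

lemma computable_min [computable_intros]:
  "computable f \<Longrightarrow> computable g \<Longrightarrow> computable (\<lambda>x. min (f x) (g x))"
  unfolding min_def by (intro computable_intros)

section \<open>The pairing function and its inverse\<close>

lemma computable_triangle: "computable triangle"
proof -
  have "rec_nat 0 (\<lambda>n r. r + Suc n) a = triangle a" for a
    by (induction a) auto
  then show ?thesis
    using total_recursive_rec_nat[OF tr_zero
        total_recursive_plus[OF tr_proj[of 1] total_recursive_Suc[OF tr_proj[of 0]]]
        tr_proj[of 0] tr_zero]
    unfolding computable_iff by (simp add: arg_def)
qed

lemma computable_prod_encode [computable_intros]:
  assumes "computable f" "computable g"
  shows "computable (\<lambda>x. prod_encode (f x, g x))"
  using computable_plus[OF computable_compose[OF computable_triangle computable_plus[OF assms]]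
      assms(1)]
  by (simp add: prod_encode_def)

definition pfst :: "nat \<Rightarrow> nat" where "pfst n = fst (prod_decode n)"
definition psnd :: "nat \<Rightarrow> nat" where "psnd n = snd (prod_decode n)"

lemma pfst_prod_encode [simp]: "pfst (prod_encode (a, b)) = a"
  and psnd_prod_encode [simp]: "psnd (prod_encode (a, b)) = b"
  by (simp_all add: pfst_def psnd_def)

lemma prod_encode_pfst_psnd [simp]: "prod_encode (pfst n, psnd n) = n"
  by (simp add: pfst_def psnd_def)

lemma pfst_0 [simp]: "pfst 0 = 0" and psnd_0 [simp]: "psnd 0 = 0"
  by (simp_all add: pfst_def psnd_def prod_decode_def prod_decode_aux.simps)

text \<open>The number of the Cantor diagonal through \<open>n\<close>, which is
  \<open>a + b\<close> for the pair \<open>(a, b)\<close>: the truncated difference vanishes iff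
  \<open>n < triangle (Suc k)\<close>. This is the only use of minimization.\<close>

definition diagonal :: "nat \<Rightarrow> nat" where
  "diagonal n = (LEAST k. Suc n - triangle (Suc k) = 0)"

lemma diagonal_prod_encode: "diagonal (prod_encode (a, b)) = a + b"
  unfolding diagonal_def
proof (rule Least_equality)
  show "Suc (prod_encode (a, b)) - triangle (Suc (a + b)) = 0"
    by (simp add: prod_encode_def)
next
  fix k
  assume *: "Suc (prod_encode (a, b)) - triangle (Suc k) = 0"
  have mono: "triangle i \<le> triangle j" if "i \<le> j" for i j
    using that by (induction rule: dec_induct) auto
  show "a + b \<le> k"
  proof (rule ccontr)
    assume "\<not> a + b \<le> k"
    then have "triangle (Suc k) \<le> triangle (a + b)" by (intro mono) simp
    with * show False by (simp add: prod_encode_def)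
  qed
qed

lemma computable_diagonal: "computable diagonal"
proof -
  have *: "total_recursive (\<lambda>xs. Suc (arg 1 xs) - triangle (Suc (arg 0 xs)))"
    by (intro total_recursive_diff total_recursive_Suc tr_proj
        total_recursive_computable[OF computable_triangle])
  have "Suc (arg 1 (arg 0 xs # xs)) - triangle (Suc (arg 0 (arg 0 xs # xs))) = 0" for xs
  proof -
    have "n \<le> triangle n" for n by (induction n) auto
    then show ?thesis by (simp add: arg_def)
  qed
  then have "\<forall>xs. \<exists>n. Suc (arg 1 (n # xs)) - triangle (Suc (arg 0 (n # xs))) = 0"
    by blast
  from tr_mu[OF * this] show ?thesis
    unfolding computable_iff diagonal_def by (simp add: arg_def cong: if_cong)
qed

lemma computable_pfst [computable_intros]:
  assumes "computable f"
  shows "computable (\<lambda>x. pfst (f x))"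
proof -
  have "pfst n = n - triangle (diagonal n)" for n
  proof -
    obtain a b where "n = prod_encode (a, b)" by (metis prod_encode_pfst_psnd)
    then show ?thesis by (simp add: diagonal_prod_encode) (simp add: prod_encode_def)
  qed
  then show ?thesis
    using computable_diff[OF assms computable_compose[OF computable_triangle
        computable_compose[OF computable_diagonal assms]]] by simp
qed

lemma computable_psnd [computable_intros]:
  assumes "computable f"
  shows "computable (\<lambda>x. psnd (f x))"
proof -
  have "psnd n = diagonal n - pfst n" for n
    by (metis add_diff_cancel_left' diagonal_prod_encode prod_encode_pfst_psnd)
  then show ?thesis
    using computable_diff[OF computable_compose[OF computable_diagonal assms] computable_pfst[OF assms]]
    by simp
qed

text \<open>Functions of several arguments, such as the body of a recursion, are treated as unary functions
  of a pair, so that the rules also apply below binders.\<close>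

lemma computable_rec_nat [computable_intros]:
  assumes "computable f" "computable (\<lambda>p. g (pfst p) (pfst (psnd p)) (psnd (psnd p)))" "computable h"
  shows "computable (\<lambda>x. rec_nat (f x) (\<lambda>n r. g x n r) (h x))"
proof -
  have pair: "total_recursive (\<lambda>xs. prod_encode (f xs, g xs))"
    if "total_recursive f" "total_recursive g" for f g
    using total_recursive_plus[OF total_recursive_computable[OF computable_triangle
        total_recursive_plus[OF that]] that(1)]
    by (simp add: prod_encode_def)
  have "total_recursive (\<lambda>xs. g (arg 2 xs) (arg 0 xs) (arg 1 xs))"
    using total_recursive_computable[OF assms(2) pair[OF tr_proj[of 2] pair[OF tr_proj[of 0] tr_proj[of 1]]]]
    by simp
  from total_recursive_rec_nat[OF assms(1)[unfolded computable_iff] this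
      assms(3)[unfolded computable_iff] tr_proj[of 0]]
  show ?thesis unfolding computable_iff by (simp add: arg_def)
qed

lemma computable_power [computable_intros]:
  assumes "computable f" "computable g"
  shows "computable (\<lambda>x. f x ^ g x)"
proof -
  have rec: "rec_nat 1 (\<lambda>n r. r * a) k = a ^ k" for a k :: nat
    by (induction k) auto
  have "computable (\<lambda>x. rec_nat 1 (\<lambda>n r. r * f x) (g x))"
    using assms by (intro computable_intros computable_compose[OF assms(1)])
  then show ?thesis by (simp only: rec)
qed

text \<open>The accumulator is the quotient of the numbers counted so far; it grows exactly when the
  next multiple of \<open>b\<close> is reached.\<close>

lemma rec_nat_div:
  fixes a b :: nat
  assumes "b > 0"
  shows "rec_nat 0 (\<lambda>n r. if Suc r * b \<le> Suc n then Suc r else r) a = a div b"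
proof (induction a)
  case (Suc a)
  have "Suc (a div b) * b \<le> Suc a \<longleftrightarrow> Suc (a mod b) = b"
    using mod_less_divisor[OF assms, of a] div_mult_mod_eq[of a b] unfolding mult_Suc by linarith
  then show ?case using Suc by (simp add: div_Suc mod_Suc)
qed simp

lemma computable_div [computable_intros]:
  assumes "computable f" "computable g" "\<And>x. g x > 0"
  shows "computable (\<lambda>x. f x div g x)"
proof -
  have "computable (\<lambda>x. rec_nat 0 (\<lambda>n r. if Suc r * g x \<le> Suc n then Suc r else r) (f x))"
    using assms(1) by (intro computable_intros computable_compose[OF assms(2)])
  then show ?thesis by (simp only: rec_nat_div[OF assms(3)])
qed

lemma decidable_odd [computable_intros]:
  assumes "computable f"
  shows "decidable (\<lambda>x. odd (f x))"
proof -
  have "odd n \<longleftrightarrow> n \<noteq> 2 * (n div 2)" for n :: nat by presburger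
  moreover have "decidable (\<lambda>x. f x \<noteq> 2 * (f x div 2))"
    using assms by (intro computable_intros) auto
  ultimately show ?thesis by (simp only:)
qed

lemma decidable_mem_set_decode [computable_intros]:
  assumes "computable f" "computable g"
  shows "decidable (\<lambda>x. f x \<in> set_decode (g x))"
  unfolding set_decode_def mem_Collect_eq using assms by (intro computable_intros) auto

section \<open>Computable families of finite sets\<close>

text \<open>Finiteness is part of the notion because \<open>set_encode\<close> sends every infinite
  set to \<open>0\<close>.\<close>

definition computable_set :: "(nat \<Rightarrow> nat set) \<Rightarrow> bool" where
  "computable_set S \<longleftrightarrow> (\<forall>x. finite (S x)) \<and> computable (\<lambda>x. set_encode (S x))"

lemma computable_setD:
  assumes "computable_set S"
  shows "finite (S x)" "computable (\<lambda>x. set_encode (S x))"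
  using assms by (auto simp: computable_set_def)

lemma computable_set_empty [computable_intros]: "computable_set (\<lambda>x. {})"
  by (simp add: computable_set_def computable_const)

lemma computable_set_singleton [computable_intros]:
  assumes "computable f"
  shows "computable_set (\<lambda>x. {f x})"
  unfolding computable_set_def using assms by (auto simp: set_encode_def intro!: computable_intros)

lemma computable_set_if [computable_intros]:
  assumes "decidable P" "computable_set S" "computable_set R"
  shows "computable_set (\<lambda>x. if P x then S x else R x)"
  unfolding computable_set_def if_distrib[of set_encode]
  using assms by (auto simp: computable_set_def intro!: computable_intros)

lemma computable_set_decode [computable_intros]:
  "computable f \<Longrightarrow> computable_set (\<lambda>x. set_decode (f x))"
  by (simp add: computable_set_def)

text \<open>Bits are added one by one and only where absent, since adding the codes would carry at
  common elements. Elements of a coded set lie below its code, so \<open>b\<close> iterations reach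
  all of them.\<close>

definition union_code :: "nat \<Rightarrow> nat \<Rightarrow> nat" where
  "union_code a b = rec_nat a
     (\<lambda>n r. if n \<in> set_decode b then if n \<in> set_decode r then r else r + 2 ^ n else r) b"

lemma less_set_encode: "n < set_encode A" if "finite A" "n \<in> A"
proof -
  have "n < 2 ^ n" by simp
  also have "\<dots> \<le> set_encode A"
    unfolding set_encode_def using that by (intro member_le_sum) auto
  finally show ?thesis .
qed

lemma set_decode_less: "n \<in> set_decode b \<Longrightarrow> n < b"
  using less_set_encode[of "set_decode b" n] by simp

lemma union_code_eq: "union_code a b = set_encode (set_decode a \<union> set_decode b)"
proof -
  have "rec_nat a (\<lambda>n r. if n \<in> set_decode b then if n \<in> set_decode r then r else r + 2 ^ n else r) k
      = set_encode (set_decode a \<union> (set_decode b \<inter> {..<k}))" for k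
  proof (induction k)
    case (Suc k)
    have "{..<Suc k} = insert k {..<k}" by auto
    then show ?case
      using Suc by (auto simp: Int_insert_right insert_absorb)
  qed simp
  from this[of b] show ?thesis
    unfolding union_code_def using set_decode_less[of _ b]
    by (simp add: Int_absorb2 subset_eq)
qed

lemma computable_union_code [computable_intros]:
  assumes "computable f" "computable g"
  shows "computable (\<lambda>x. union_code (f x) (g x))"
  unfolding union_code_def
  using assms(1) by (intro computable_intros computable_compose[OF assms(2)] assms(2))

lemma computable_set_Un [computable_intros]:
  assumes "computable_set S" "computable_set R"
  shows "computable_set (\<lambda>x. S x \<union> R x)"
  using computable_union_code[OF computable_setD(2)[OF assms(1)] computable_setD(2)[OF assms(2)]]
  by (simp add: computable_set_def union_code_eq computable_setD(1)[OF assms(1)]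
      computable_setD(1)[OF assms(2)])

text \<open>The union is accumulated over all \<open>i\<close> below the code of \<open>A x\<close>.
  The family is unary in a pair, which lets the rule apply to nested unions.\<close>

lemma computable_set_UN [computable_intros]:
  assumes "computable_set A" "computable_set (\<lambda>p. S (pfst p) (psnd p))"
  shows "computable_set (\<lambda>x. \<Union>i\<in>A x. S x i)"
proof -
  have fin: "finite (S x i)" for x i
    using computable_setD(1)[OF assms(2), of "prod_encode (x, i)"] by simp
  have rec: "rec_nat 0 (\<lambda>i r. if i \<in> set_decode (set_encode (A x))
      then union_code r (set_encode (S x i)) else r) k
      = set_encode (\<Union>i\<in>A x \<inter> {..<k}. S x i)" for x k
  proof (induction k)
    case (Suc k)
    have "{..<Suc k} = insert k {..<k}" by auto
    then show ?case
      using Suc fin computable_setD(1)[OF assms(1)]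
      by (auto simp: Int_insert_right union_code_eq Un_commute)
  qed simp
  have sub: "A x \<inter> {..<set_encode (A x)} = A x" for x
    using less_set_encode[OF computable_setD(1)[OF assms(1)]] by auto
  have "computable (\<lambda>x. rec_nat 0 (\<lambda>i r. if i \<in> set_decode (set_encode (A x))
      then union_code r (set_encode (S x i)) else r) (set_encode (A x)))"
  proof (intro computable_intros computable_setD(2)[OF assms(1)])
    show "computable (\<lambda>p. set_encode (A (pfst p)))"
      by (intro computable_compose[OF computable_setD(2)[OF assms(1)]] computable_intros)
    have "computable (\<lambda>p. prod_encode (pfst p, pfst (psnd p)))"
      by (intro computable_intros)
    from computable_compose[OF computable_setD(2)[OF assms(2)] this]
    show "computable (\<lambda>p. set_encode (S (pfst p) (pfst (psnd p))))" by simp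
  qed
  then show ?thesis
    unfolding rec sub computable_set_def using computable_setD(1)[OF assms(1)] fin by auto
qed

lemma computable_set_lessThan [computable_intros]:
  assumes "computable f"
  shows "computable_set (\<lambda>x. {..<f x})"
proof -
  have "Suc (set_encode {..<k}) = 2 ^ k" for k
  proof (induction k)
    case (Suc k)
    with Suc show ?case by (simp add: lessThan_Suc)
  qed simp
  then have "set_encode {..<k} = 2 ^ k - 1" for k
    by (metis diff_Suc_1)
  then show ?thesis
    unfolding computable_set_def using assms by (simp add: computable_intros)
qed

section \<open>Conflict-free transducers\<close>

lemma computation_Cons_iff:
  "computation T c (t # ts) c' \<longleftrightarrow>
     t \<in> transitions T \<and> enabled t c \<and> computation T (fire t c) ts c'"
  by (auto elim: computation.cases intro: computation_Cons)

lemma computation_append: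
  assumes "computation T c ts c'" "computation T c' us c''"
  shows "computation T c (ts @ us) c''"
  using assms by induction (auto intro: computation_Cons)

lemma computation_single:
  "t \<in> transitions T \<Longrightarrow> enabled t c \<Longrightarrow> computation T c [t] (fire t c)"
  by (intro computation_Cons computation_Nil)

lemma emission_simps [simp]:
  "emission [] = 0" "emission (t # ts) = emits t + emission ts"
  "emission (ts @ us) = emission ts + emission us"
  by (simp_all add: emission_def)

definition terminal :: "'a transducer \<Rightarrow> 'a config \<Rightarrow> bool" where
  "terminal T c \<longleftrightarrow> (\<forall>t\<in>transitions T. \<not> enabled t c)"

text \<open>All configurations are considered, not only reachable ones, so that no invariant of runs
  enters.\<close>

definition conflict_free :: "'a transducer \<Rightarrow> bool" where
  "conflict_free T \<longleftrightarrow>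
     (\<forall>c. \<forall>t\<in>transitions T. \<forall>t'\<in>transitions T. enabled t c \<and> enabled t' c \<longrightarrow> t = t')"

lemma conflict_freeD:
  "conflict_free T \<Longrightarrow> t \<in> transitions T \<Longrightarrow> t' \<in> transitions T \<Longrightarrow> enabled t c \<Longrightarrow> enabled t' c
    \<Longrightarrow> t = t'"
  unfolding conflict_free_def by blast

text \<open>Runs cannot branch and cannot be prolonged at a dead end. One explicit run to a terminal
  configuration therefore settles what every successful computation emits.\<close>

lemma terminal_computation_unique:
  assumes "conflict_free T"
    and "computation T c ts c1" "terminal T c1" "computation T c us c2" "terminal T c2"
  shows "us = ts \<and> c2 = c1"
  using assms(2-5)
proof (induction arbitrary: us)
  case (computation_Nil c)
  from computation_Nil(2) show ?case
    by cases (use computation_Nil(1) in \<open>auto simp: terminal_def\<close>)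
next
  case (computation_Cons t c ts c1)
  from computation_Cons(6) show ?case
  proof cases
    case computation_Nil
    then show ?thesis
      using computation_Cons.hyps computation_Cons.prems by (auto simp: terminal_def)
  next
    case (computation_Cons t' ts')
    with computation_Cons.hyps have "t' = t"
      using conflict_freeD[OF assms(1)] by blast
    with computation_Cons computation_Cons.IH computation_Cons.prems show ?thesis by auto
  qed
qed

text \<open>A routine may stop where a reading transition is still enabled, so
  \<open>terminal\<close> is too strong here; restricting both runs to internal transitions restores
  the argument.\<close>

lemma internal_run_unique:
  assumes "conflict_free T"
    and "computation T c ts c1" "\<forall>s\<in>set ts. reads s = None" "no_internal_enabled T c1"
    and "computation T c us c2" "\<forall>s\<in>set us. reads s = None" "no_internal_enabled T c2"
  shows "us = ts"
  using assms(2-7)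
proof (induction arbitrary: us)
  case (computation_Nil c)
  from computation_Nil(3) show ?case
    by cases (use computation_Nil in \<open>auto simp: no_internal_enabled_def\<close>)
next
  case (computation_Cons t c ts c1)
  from computation_Cons(7) show ?case
  proof cases
    case computation_Nil
    then show ?thesis
      using computation_Cons.hyps computation_Cons.prems by (auto simp: no_internal_enabled_def)
  next
    case (computation_Cons t' ts')
    with computation_Cons.hyps have "t' = t"
      using conflict_freeD[OF assms(1)] by blast
    with computation_Cons computation_Cons.IH computation_Cons.prems show ?thesis by auto
  qed
qed

text \<open>Self-loops are allowed if they decrement, because the counter is then a secondary rank.\<close>

definition internally_terminating :: "'a transducer \<Rightarrow> bool" where
  "internally_terminating T \<longleftrightarrow> (\<exists>rank :: nat \<Rightarrow> nat. \<forall>t\<in>transitions T. reads t = None \<longrightarrow>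
     rank (target t) < rank (source t) \<or> target t = source t \<and> action t = Dec)"

lemma internal_run_exists:
  assumes "internally_terminating T"
  shows "\<exists>ts c'. computation T c ts c' \<and> (\<forall>s\<in>set ts. reads s = None) \<and> no_internal_enabled T c'"
proof -
  from assms obtain rank :: "nat \<Rightarrow> nat" where rank: "\<And>t. t \<in> transitions T \<Longrightarrow> reads t = None \<Longrightarrow>
     rank (target t) < rank (source t) \<or> target t = source t \<and> action t = Dec"
    unfolding internally_terminating_def by blast
  let ?R = "inv_image (less_than <*lex*> less_than) (\<lambda>c :: 'a config. (rank (fst c), fst (snd c)))"
  have "wf ?R" by (intro wf_inv_image wf_lex_prod wf_less_than)
  then show ?thesis
  proof (induction c)
    case (less c)
    show ?case
    proof (cases "no_internal_enabled T c")
      case True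
      then show ?thesis by (intro exI[of _ "[]"] exI[of _ c]) (simp add: computation_Nil)
    next
      case False
      then obtain t where t: "t \<in> transitions T" "enabled t c" "reads t = None"
        by (auto simp: no_internal_enabled_def)
      have "(fire t c, c) \<in> ?R"
        using rank[OF t(1,3)] t(2,3) by (cases c) auto
      from less[OF this] obtain ts c' where
        "computation T (fire t c) ts c'" "\<forall>s\<in>set ts. reads s = None" "no_internal_enabled T c'"
        by blast
      with t show ?thesis
        by (intro exI[of _ "t # ts"] exI[of _ c']) (auto intro: computation_Cons)
    qed
  qed
qed

lemma letter_routine_Cons:
  "letter_routine T c (t # ts) \<longleftrightarrow> t \<in> transitions T \<and> enabled t c \<and>
     (\<exists>\<sigma>. reads t = Some (Letter \<sigma>)) \<and> (\<forall>s\<in>set ts. reads s = None) \<and>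
     (\<exists>c'. computation T (fire t c) ts c' \<and> no_internal_enabled T c')"
  unfolding letter_routine_def by (auto simp: computation_Cons_iff simp del: enabled.simps fire.simps)

lemma unique_finite_routines_if_internally_terminating:
  assumes "conflict_free T" "internally_terminating T"
  shows "unique_finite_routines \<Sigma> T"
  unfolding unique_finite_routines_def
proof (intro ballI allI impI, elim conjE)
  fix q n \<sigma> u
  let ?c = "(q, n, Letter \<sigma> # u) :: 'a config"
  assume quiet: "no_internal_enabled T ?c"
  show "\<exists>!ts. letter_routine T ?c ts"
  proof (cases "\<exists>t\<in>transitions T. enabled t ?c")
    case False
    then show ?thesis
      by (intro ex1I[of _ "[]"]) (auto simp: letter_routine_def computation_Cons_iff
          simp del: enabled.simps split: list.splits)
  next
    case True
    then obtain t where t: "t \<in> transitions T" "enabled t ?c" by blast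
    moreover from this quiet have "reads t = Some (Letter \<sigma>)"
      by (auto simp: no_internal_enabled_def split: option.splits)
    moreover obtain ts c' where ts: "computation T (fire t ?c) ts c'" "\<forall>s\<in>set ts. reads s = None"
      "no_internal_enabled T c'"
      using internal_run_exists[OF assms(2)] by blast
    ultimately have run: "letter_routine T ?c (t # ts)" unfolding letter_routine_Cons by blast
    show ?thesis
    proof (rule ex1I[of "letter_routine T ?c", OF run])
      fix us
      assume us: "letter_routine T ?c us"
      show "us = t # ts"
      proof (cases us)
        case Nil
        with us t show ?thesis by (auto simp: letter_routine_def)
      next
        case (Cons t' us')
        with us obtain c'' where us': "t' \<in> transitions T" "enabled t' ?c"
          "\<forall>s\<in>set us'. reads s = None" "computation T (fire t' ?c) us' c''"
          "no_internal_enabled T c''"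
          using letter_routine_Cons[of T ?c t' us'] by blast
        from us' t have "t' = t" using conflict_freeD[OF assms(1)] by blast
        with us' Cons show ?thesis
          using internal_run_unique[OF assms(1) ts] by blast
      qed
    qed
  qed
qed

lemma deterministic_if_conflict_free: "conflict_free T \<Longrightarrow> deterministic \<Sigma> T"
  unfolding conflict_free_def deterministic_def by blast

section \<open>Normal forms of vectors\<close>

text \<open>\<open>lhd\<close> and \<open>ltl\<close> are head and tail on list codes:
  \<open>list_encode\<close> of a nonempty list is the successor of a pair code.\<close>

definition lhd :: "nat \<Rightarrow> nat" where "lhd c = pfst (c - 1)"
definition ltl :: "nat \<Rightarrow> nat" where "ltl c = psnd (c - 1)"

lemma lhd_ltl_Suc [simp]:
  "lhd (Suc (prod_encode (x, y))) = x" "ltl (Suc (prod_encode (x, y))) = y"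
  by (simp_all add: lhd_def ltl_def)

lemma lhd_ltl_0 [simp]: "lhd 0 = 0" "ltl 0 = 0"
  by (simp_all add: lhd_def ltl_def)

text \<open>If \<open>n\<close> bounds the code of an entry, its offset form is \<open>0\<close> for \<open>NegInf\<close> and \<open>k + n + 1\<close> for
  \<open>Fin k\<close>. Maxima are then maxima of natural numbers.\<close>

definition zoff :: "nat \<Rightarrow> nat \<Rightarrow> nat" where
  "zoff n z = (if z = 0 then 0 else if odd z then Suc n + z div 2 else Suc n - z div 2)"

text \<open>Undoes the offset form and adds \<open>s\<close>, the amount emitted so far.\<close>

definition val :: "nat \<Rightarrow> int \<Rightarrow> nat \<Rightarrow> zmax" where
  "val n s z = (if z = 0 then NegInf else Fin (s + int z - 1 - int n))"

text \<open>Max-plus multiplication by \<open>Fin k\<close> on offset forms, with \<open>0\<close>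
  absorbing in the role of \<open>NegInf\<close>.\<close>

definition shift :: "nat \<Rightarrow> nat \<Rightarrow> nat" where
  "shift z k = (if z = 0 then 0 else z + k)"

text \<open>The bound keeps the subtraction \<open>Suc n - z div 2\<close> in \<open>zoff\<close>
  from being truncated.\<close>

lemma val_zoff:
  assumes "zmax_code z \<le> n"
  shows "val n s (zoff n (zmax_code z)) = Fin s * z"
proof (cases z)
  case (Fin k)
  with assms show ?thesis
    by (auto simp: val_def zoff_def int_encode_def sum_encode_def)
qed (simp add: val_def zoff_def)

lemma zoff_le: "z \<le> n \<Longrightarrow> zoff n z \<le> Suc (2 * n)"
  by (auto simp: zoff_def)

lemma val_max: "val n s (max x y) = val n s x + val n s y"
  by (auto simp: val_def max_def)

lemma val_shift: "val n s (shift z k) = val n (s + int k) z"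
  by (auto simp: val_def shift_def)

lemma val_0 [simp]: "val n s 0 = NegInf"
  by (simp add: val_def)

text \<open>The four kinds \<open>q\<close> of normal forms: with \<open>s\<close> emitted so far and counter value \<open>k\<close>, they stand for
  the vectors \<open>(s, -\<infinity>)\<close>, \<open>(-\<infinity>, s)\<close>, \<open>(s, s + k)\<close> and \<open>(s + k, s)\<close>. The base row of a matrix belongs to the
  coordinate \<open>s\<close>, the other row to \<open>s + k\<close>; the code \<open>0\<close> acts as a row with both entries \<open>-\<infinity>\<close>.\<close>

definition base_row :: "nat \<Rightarrow> nat \<Rightarrow> nat" where
  "base_row q M = (if q = 0 \<or> q = 2 then lhd M else lhd (ltl M))"

definition other_row :: "nat \<Rightarrow> nat \<Rightarrow> nat" where
  "other_row q M = (if q < 2 then 0 else if q = 2 then lhd (ltl M) else lhd M)"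

definition res1 :: "nat \<Rightarrow> nat \<Rightarrow> nat \<Rightarrow> nat \<Rightarrow> nat" where
  "res1 n M q k = max (zoff n (lhd (base_row q M))) (shift (zoff n (lhd (other_row q M))) k)"

definition res2 :: "nat \<Rightarrow> nat \<Rightarrow> nat \<Rightarrow> nat \<Rightarrow> nat" where
  "res2 n M q k =
     max (zoff n (lhd (ltl (base_row q M)))) (shift (zoff n (lhd (ltl (other_row q M)))) k)"

definition zvec :: "zmax \<Rightarrow> zmax \<Rightarrow> zmax ^ 2" where
  "zvec x y = (\<chi> i. if i = 1 then x else y)"

lemma zvec_nth [simp]: "zvec x y $ 1 = x" "zvec x y $ 2 = y"
  by (simp_all add: zvec_def)

lemma zmax_vec_eq_iff: "v = w \<longleftrightarrow> v $ 1 = w $ 1 \<and> v $ 2 = w $ 2" for v w :: "zmax ^ 2"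
  by (simp add: vec_eq_iff forall_2)

definition rep :: "nat \<Rightarrow> nat \<Rightarrow> int \<Rightarrow> zmax ^ 2" where
  "rep q k s = zvec
     (if q = 1 then NegInf else if q = 3 then Fin (s + int k) else Fin s)
     (if q = 0 then NegInf else if q = 2 then Fin (s + int k) else Fin s)"

lemma less_4_cases: "(q :: nat) < 4 \<Longrightarrow> q = 0 \<or> q = 1 \<or> q = 2 \<or> q = 3"
  by linarith

lemma rep_mult:
  assumes "q < 4" and "\<And>i j. zmax_code (M $ i $ j) \<le> n"
  shows "(rep q k s v* M) $ 1 = val n s (res1 n (mat_code M) q k)"
    and "(rep q k s v* M) $ 2 = val n s (res2 n (mat_code M) q k)"
  using less_4_cases[OF assms(1)]
  by (auto simp: vector_matrix_mult_def rep_def sum_2 res1_def res2_def val_max val_shift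
      base_row_def other_row_def mat_code_def vec_code_def val_zoff[OF assms(2)] add_ac times_zmax.simps
      zoff_def[of n 0] shift_def[of 0] max_def[of _ 0])

text \<open>The kind, in the numbering of \<open>rep\<close>, for coordinates in offset form. A tie
  is kind 2 with difference \<open>0\<close>; the pair \<open>(0, 0)\<close> has no normal form, and
  its value here is a default.\<close>

definition nf_type :: "nat \<Rightarrow> nat \<Rightarrow> nat" where
  "nf_type x y = (if y = 0 then 0 else if x = 0 then 1 else if x \<le> y then 2 else 3)"

definition nf_diff :: "nat \<Rightarrow> nat \<Rightarrow> nat" where
  "nf_diff x y = (if x = 0 \<or> y = 0 then 0 else (x - y) + (y - x))"

definition nf_base :: "nat \<Rightarrow> nat \<Rightarrow> nat" where
  "nf_base x y = (if y = 0 then x else if x = 0 then y else min x y)"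

definition nf_emit :: "nat \<Rightarrow> nat \<Rightarrow> nat \<Rightarrow> int" where
  "nf_emit n x y = int (nf_base x y) - 1 - int n"

lemma rep_nf:
  assumes "x \<noteq> 0 \<or> y \<noteq> 0"
  shows "rep (nf_type x y) (nf_diff x y) (s + nf_emit n x y) =
    zvec (val n s x) (val n s y)"
  using assms by (auto simp: rep_def nf_type_def nf_diff_def nf_base_def nf_emit_def val_def zmax_vec_eq_iff)

section \<open>The simulating transducer\<close>

text \<open>States with \<open>r = 0\<close> add \<open>j\<close> to the counter and then wait for input in \<open>state q 0 0\<close>. States
  with \<open>r > 0\<close> process the instruction with number \<open>r\<close>, after \<open>j\<close> has been subtracted from the
  counter.\<close>

definition state :: "nat \<Rightarrow> nat \<Rightarrow> nat \<Rightarrow> nat" where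
  "state q r j = prod_encode (q, prod_encode (r, j))"

lemma state_eq_iff [simp]: "state q r j = state q' r' j' \<longleftrightarrow> q = q' \<and> r = r' \<and> j = j'"
  by (simp add: state_def)

text \<open>Once the counter value reaches \<open>cap n\<close>, every finite entry of the other row wins against the
  base row. If exactly one coordinate then grows with the counter while the other is a finite
  constant, the counter is kept; otherwise it is emptied, and each decrement changes both finite
  coordinates by \<open>gain\<close>.\<close>

definition cap :: "nat \<Rightarrow> nat" where
  "cap n = Suc (2 * n)"

definition keep :: "nat \<Rightarrow> nat \<Rightarrow> nat \<Rightarrow> bool" where
  "keep n M q \<longleftrightarrow>
     lhd (other_row q M) \<noteq> 0 \<and> lhd (ltl (other_row q M)) = 0 \<and> lhd (ltl (base_row q M)) \<noteq> 0 \<or>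
     lhd (other_row q M) = 0 \<and> lhd (ltl (other_row q M)) \<noteq> 0 \<and> lhd (base_row q M) \<noteq> 0"

definition gain :: "nat \<Rightarrow> nat \<Rightarrow> nat" where
  "gain M q = (if lhd (other_row q M) = 0 \<and> lhd (ltl (other_row q M)) = 0 then 0 else 1)"

definition entries_le :: "nat \<Rightarrow> nat \<Rightarrow> bool" where
  "entries_le n M \<longleftrightarrow> lhd (lhd M) \<le> n \<and> lhd (ltl (lhd M)) \<le> n \<and>
     lhd (lhd (ltl M)) \<le> n \<and> lhd (ltl (lhd (ltl M))) \<le> n"

lemma zoff_eq_0_iff [simp]: "z \<le> n \<Longrightarrow> zoff n z = 0 \<longleftrightarrow> z = 0"
  by (auto simp: zoff_def)

text \<open>Origin of \<open>cap\<close>: no offset form of an entry exceeds \<open>cap n\<close>,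
  and that of a finite entry is positive.\<close>

lemma zoff_less: "a \<le> n \<Longrightarrow> b \<le> n \<Longrightarrow> b \<noteq> 0 \<Longrightarrow> zoff n a < zoff n b + cap n"
  by (auto simp: zoff_def cap_def)

lemma entries_leD:
  assumes "entries_le n M"
  shows "lhd (base_row q M) \<le> n" "lhd (ltl (base_row q M)) \<le> n"
    "lhd (other_row q M) \<le> n" "lhd (ltl (other_row q M)) \<le> n"
  using assms by (auto simp: entries_le_def base_row_def other_row_def)

text \<open>An offset form and a shift contribute at most \<open>cap n\<close> each. The sum tells
  how many filling states \<open>inc_tr\<close> has to provide.\<close>

lemma res_le:
  assumes "entries_le n M" "k \<le> cap n"
  shows "res1 n M q k \<le> 2 * cap n" "res2 n M q k \<le> 2 * cap n"
  using entries_leD[OF assms(1), of q, THEN zoff_le] assms(2)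
  by (auto simp: res1_def res2_def shift_def cap_def)

lemma nf_diff_le: "x \<le> b \<Longrightarrow> y \<le> b \<Longrightarrow> nf_diff x y \<le> b"
  by (auto simp: nf_diff_def)

lemma nf_type_less: "nf_type x y < 4"
  by (simp add: nf_type_def)

text \<open>If both entries of the other row are finite, both coordinates grow; if neither is, none
  does. If exactly one is, the failure of \<open>keep\<close> makes the remaining coordinate
  \<open>NegInf\<close>, which \<open>shift\<close> leaves alone. In every case one unit of the
  counter is a uniform shift.\<close>

lemma res_beyond_cap:
  assumes "entries_le n M" "\<not> keep n M q"
  shows "res1 n M q (cap n + Suc k) = shift (res1 n M q (cap n + k)) (gain M q)"
    and "res2 n M q (cap n + Suc k) = shift (res2 n M q (cap n + k)) (gain M q)"
  using entries_leD[OF assms(1), of q] entries_leD[OF assms(1), of q, THEN zoff_le] assms(2)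
  by (auto simp: res1_def res2_def shift_def cap_def keep_def gain_def max_def)

lemma rep_keep:
  assumes "entries_le n M" "keep n M q"
  defines "x \<equiv> res1 n M q (cap n)" and "y \<equiv> res2 n M q (cap n)"
  shows "x \<noteq> 0 \<and> y \<noteq> 0"
    and "rep (nf_type x y) (nf_diff x y + k) (s + nf_emit n x y) =
      zvec (val n s (res1 n M q (cap n + k))) (val n s (res2 n M q (cap n + k)))"
proof -
  note le = entries_leD[OF assms(1), of q] entries_leD[OF assms(1), of q, THEN zoff_le]
  consider (1) "lhd (other_row q M) \<noteq> 0" "lhd (ltl (other_row q M)) = 0" "lhd (ltl (base_row q M)) \<noteq> 0"
    | (2) "lhd (other_row q M) = 0" "lhd (ltl (other_row q M)) \<noteq> 0" "lhd (base_row q M) \<noteq> 0"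
    using assms(2) unfolding keep_def by argo
  then show nz: "x \<noteq> 0 \<and> y \<noteq> 0"
    using le by cases (auto simp: x_def y_def res1_def res2_def shift_def cap_def max_def)
  note lt = zoff_less[OF le(2,3)] zoff_less[OF le(1,4)]
  \<comment> \<open>At the cap the growing coordinate already exceeds the constant one, so the kind
    is final and the remaining \<open>k\<close> only adds to the difference.\<close>
  have "y < x \<and> res1 n M q (cap n + k) = x + k \<and> res2 n M q (cap n + k) = y \<or>
    x < y \<and> res1 n M q (cap n + k) = x \<and> res2 n M q (cap n + k) = y + k"
    using \<open>keep n M q\<close> le lt unfolding x_def y_def keep_def
    by (auto simp: res1_def res2_def shift_def cap_def zoff_def[of n 0] max_def)
  then show "rep (nf_type x y) (nf_diff x y + k) (s + nf_emit n x y) =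
      zvec (val n s (res1 n M q (cap n + k))) (val n s (res2 n M q (cap n + k)))"
    using nz by (auto simp: rep_def nf_type_def nf_diff_def nf_base_def nf_emit_def val_def zmax_vec_eq_iff)
qed

definition inc_tr :: "nat \<Rightarrow> nat \<Rightarrow> 'a transition" where
  "inc_tr q m = \<lparr>source = state q 0 (Suc m), reads = None, action = Inc, emits = 0,
     target = state q 0 m\<rparr>"

definition read_tr :: "nat \<Rightarrow> 'a symbol option \<Rightarrow> nat \<Rightarrow> 'a transition" where
  "read_tr r rd q = \<lparr>source = state q 0 0, reads = rd, action = NoAction, emits = 0,
     target = state q r 0\<rparr>"

definition out_tr :: "nat \<Rightarrow> nat \<Rightarrow> nat \<Rightarrow> nat \<Rightarrow> nat \<Rightarrow> 'a transition" where
  "out_tr n M r q j = \<lparr>source = state q r j, reads = None,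
     action = (if j = cap n \<and> keep n M q then NoAction else IfZero),
     emits = nf_emit n (res1 n M q j) (res2 n M q j),
     target = state (nf_type (res1 n M q j) (res2 n M q j)) 0
       (nf_diff (res1 n M q j) (res2 n M q j))\<rparr>"

text \<open>Below the cap the index \<open>j\<close> remembers the decrement; at the cap it is a
  self-loop and the emission has to account for it.\<close>

definition dec_tr :: "nat \<Rightarrow> nat \<Rightarrow> nat \<Rightarrow> nat \<Rightarrow> nat \<Rightarrow> 'a transition" where
  "dec_tr n M r q j = \<lparr>source = state q r j, reads = None, action = Dec,
     emits = (if j = cap n then int (gain M q) else 0), target = state q r (min (Suc j) (cap n))\<rparr>"

text \<open>For \<open>rd = None\<close> the start state lies inside the gadget, hence no reading
  transition. A result without finite coordinate gets no exit: the run is stuck, which is how the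
  transducer rejects.\<close>

definition gadget :: "nat \<Rightarrow> nat \<Rightarrow> nat \<Rightarrow> 'a symbol option \<Rightarrow> nat \<Rightarrow> 'a transition set" where
  "gadget n M r rd q =
     (if rd = None then {} else {read_tr r rd q}) \<union>
     (\<Union>j\<in>{..<Suc (cap n)}. if 0 < max (res1 n M q j) (res2 n M q j) then {out_tr n M r q j} else {}) \<union>
     (\<Union>j\<in>{..<Suc (cap n)}. if j = cap n \<and> keep n M q then {} else {dec_tr n M r q j})"

lemma in_gadget_iff:
  "t \<in> gadget n M r rd q \<longleftrightarrow> rd \<noteq> None \<and> t = read_tr r rd q \<or>
     (\<exists>j\<le>cap n. 0 < max (res1 n M q j) (res2 n M q j) \<and> t = out_tr n M r q j) \<or>
     (\<exists>j\<le>cap n. (j = cap n \<longrightarrow> \<not> keep n M q) \<and> t = dec_tr n M r q j)"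
  unfolding gadget_def by (auto simp: less_Suc_eq_le simp del: less_max_iff_disj split: if_splits)

text \<open>The initial vector and the final vector are treated as matrices: \<open>None\<close> is the internal routine
  that produces the initial vector from \<open>(0, -\<infinity>)\<close>, and the end marker produces \<open>(value, -\<infinity>)\<close>.
  Hence \<open>state 0 0 0\<close> can serve as accepting state: after the end marker it is reached only with a
  finite value, and before it there is unread input.\<close>

definition instructions :: "'a set \<Rightarrow> 'a symbol option set" where
  "instructions \<Sigma> = {None, Some EndMarker} \<union> (\<lambda>\<sigma>. Some (Letter \<sigma>)) ` \<Sigma>"

fun instruction_mat :: "'a mp_automaton \<Rightarrow> 'a symbol option \<Rightarrow> zmax ^ 2 ^ 2" where
  "instruction_mat B None = (\<chi> i. mp_init B)"
| "instruction_mat B (Some EndMarker) = (\<chi> i j. if j = 1 then mp_final B $ i else NegInf)"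
| "instruction_mat B (Some (Letter \<sigma>)) = mp_mat B \<sigma>"

definition simulator_transitions ::
  "'a set \<Rightarrow> ('a \<Rightarrow> nat) \<Rightarrow> 'a mp_automaton \<Rightarrow> nat \<Rightarrow> 'a transition set" where
  "simulator_transitions \<Sigma> e B n =
     (\<Union>q\<in>{..<4}. \<Union>m\<in>{..<2 * cap n}. {inc_tr q m}) \<union>
     (\<Union>rd\<in>instructions \<Sigma>. \<Union>q\<in>{..<4}.
        gadget n (mat_code (instruction_mat B rd)) (Suc (reads_code e rd)) rd q)"

text \<open>Every code bounds the numbers that it encodes, so the code of the transitions bounds their
  states.\<close>

definition simulator :: "'a set \<Rightarrow> ('a \<Rightarrow> nat) \<Rightarrow> 'a mp_automaton \<Rightarrow> 'a transducer" where
  "simulator \<Sigma> e B =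
     (let n = automaton_code \<Sigma> e B; ts = simulator_transitions \<Sigma> e B n in
      \<lparr>states = {..<Suc (set_encode (transition_code e ` ts))} \<union> {state 0 1 0, state 0 0 0},
       start = state 0 1 0, accepting = {state 0 0 0}, transitions = ts\<rparr>)"

locale simulation =
  fixes \<Sigma> :: "'a set" and e :: "'a \<Rightarrow> nat" and B :: "'a mp_automaton"
  assumes finite_alphabet: "finite \<Sigma>" and inj_code: "inj_on e \<Sigma>"
begin

definition n :: nat where "n = automaton_code \<Sigma> e B"
definition T :: "'a transducer" where "T = simulator \<Sigma> e B"
definition mc :: "'a symbol option \<Rightarrow> nat" where "mc rd = mat_code (instruction_mat B rd)"
definition rc :: "'a symbol option \<Rightarrow> nat" where "rc rd = Suc (reads_code e rd)"

lemma transitions_T: "transitions T = simulator_transitions \<Sigma> e B n"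
  by (simp add: T_def n_def simulator_def Let_def)

lemma in_transitions_iff:
  "t \<in> transitions T \<longleftrightarrow>
     (\<exists>q<4. \<exists>m<2 * cap n. t = inc_tr q m) \<or>
     (\<exists>rd\<in>instructions \<Sigma>. \<exists>q<4. rd \<noteq> None \<and> t = read_tr (rc rd) rd q) \<or>
     (\<exists>rd\<in>instructions \<Sigma>. \<exists>q<4. \<exists>j\<le>cap n. 0 < max (res1 n (mc rd) q j) (res2 n (mc rd) q j) \<and>
        t = out_tr n (mc rd) (rc rd) q j) \<or>
     (\<exists>rd\<in>instructions \<Sigma>. \<exists>q<4. \<exists>j\<le>cap n. (j = cap n \<longrightarrow> \<not> keep n (mc rd) q) \<and>
        t = dec_tr n (mc rd) (rc rd) q j)"
  unfolding transitions_T simulator_transitions_def rc_def[symmetric] mc_def[symmetric]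
    Un_iff UN_iff in_gadget_iff lessThan_iff singleton_iff by blast

lemma transition_cases [consumes 1, case_names inc read out dec]:
  assumes "t \<in> transitions T"
  obtains (inc) q m where "q < 4" "m < 2 * cap n" "t = inc_tr q m"
  | (read) rd q where "rd \<in> instructions \<Sigma>" "q < 4" "rd \<noteq> None" "t = read_tr (rc rd) rd q"
  | (out) rd q j where "rd \<in> instructions \<Sigma>" "q < 4" "j \<le> cap n"
      "0 < max (res1 n (mc rd) q j) (res2 n (mc rd) q j)" "t = out_tr n (mc rd) (rc rd) q j"
  | (dec) rd q j where "rd \<in> instructions \<Sigma>" "q < 4" "j \<le> cap n"
      "j = cap n \<longrightarrow> \<not> keep n (mc rd) q" "t = dec_tr n (mc rd) (rc rd) q j"
  using assms unfolding in_transitions_iff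
  by (elim disjE exE bexE conjE) (rule that; assumption)+

lemma rc_eq_iff:
  assumes "rd \<in> instructions \<Sigma>" "rd' \<in> instructions \<Sigma>"
  shows "rc rd = rc rd' \<longleftrightarrow> rd = rd'"
  using assms inj_code by (auto simp: rc_def instructions_def inj_on_eq_iff)

lemma rc_neq_0 [simp]: "rc rd \<noteq> 0" "0 \<noteq> rc rd"
  by (simp_all add: rc_def)

lemma finite_transitions: "finite (transitions T)"
proof -
  have "finite (instructions \<Sigma>)" using finite_alphabet by (simp add: instructions_def)
  then show ?thesis
    unfolding transitions_T simulator_transitions_def gadget_def by (intro finite_UnI finite_UN_I) auto
qed

text \<open>The source determines the family up to reading transitions, which the next symbol
  separates, and up to \<open>out_tr\<close> against \<open>dec_tr\<close>. These are separated by
  \<open>IfZero\<close> and \<open>Dec\<close>; where \<open>out_tr\<close> has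
  \<open>NoAction\<close>, \<open>dec_tr\<close> is absent. Injectivity of \<open>e\<close> keeps
  the gadgets of different letters apart.\<close>

lemma conflict_free_T: "conflict_free T"
  unfolding conflict_free_def
proof (intro allI ballI impI, elim conjE)
  fix c t t'
  assume "t \<in> transitions T" "t' \<in> transitions T" "enabled t c" "enabled t' c"
  moreover obtain q k u where "c = (q, k, u)" by (cases c)
  ultimately show "t = t'"
    by (elim transition_cases; hypsubst)
      (auto simp: inc_tr_def read_tr_def out_tr_def dec_tr_def rc_eq_iff
        split: option.splits if_splits)
qed

end

section \<open>Codes bound their components\<close>

lemma le_list_encode: "x \<in> set xs \<Longrightarrow> x \<le> list_encode xs"
proof (induction xs)
  case (Cons y ys)
  have "list_encode ys \<le> list_encode (y # ys)" "y \<le> list_encode (y # ys)"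
    using le_prod_encode_1 le_prod_encode_2 by (simp_all add: le_SucI)
  with Cons show ?case by (auto intro: order_trans)
qed simp

lemma zmax_code_le_vec_code: "zmax_code (v $ i) \<le> vec_code v"
  unfolding vec_code_def using exhaust_2[of i]
  by (auto intro!: le_list_encode simp del: list_encode.simps)

lemma vec_code_le_mat_code: "vec_code (M $ i) \<le> mat_code M"
  unfolding mat_code_def using exhaust_2[of i]
  by (auto intro!: le_list_encode simp del: list_encode.simps)

lemma entries_le_mat_code:
  assumes "\<And>i j. zmax_code (M $ i $ j) \<le> n"
  shows "entries_le n (mat_code M)"
  using assms by (simp add: entries_le_def mat_code_def vec_code_def)

lemma vector_matrix_mult_nth_2:
  fixes v :: "'a :: semiring_1 ^ 2"
  shows "(v v* M) $ j = v $ 1 * M $ 1 $ j + v $ 2 * M $ 2 $ j"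
  by (simp add: vector_matrix_mult_def sum_2)

lemma shift_0 [simp]: "shift x 0 = x"
  by (simp add: shift_def)

lemma shift_eq_0_iff [simp]: "shift x k = 0 \<longleftrightarrow> x = 0"
  by (simp add: shift_def)

context simulation
begin

lemma entries_bound:
  assumes "rd \<in> instructions \<Sigma>"
  shows "zmax_code (instruction_mat B rd $ i $ j) \<le> n"
proof (cases rd)
  case None
  have "zmax_code (mp_init B $ j) \<le> n"
    unfolding n_def automaton_code_def
    by (rule order_trans[OF zmax_code_le_vec_code le_list_encode]) simp
  with None show ?thesis by simp
next
  case (Some s)
  show ?thesis
  proof (cases s)
    case EndMarker
    have "zmax_code (mp_final B $ i) \<le> n"
      unfolding n_def automaton_code_def
      by (rule order_trans[OF zmax_code_le_vec_code le_list_encode]) simp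
    with Some EndMarker show ?thesis by simp
  next
    case (Letter \<sigma>)
    let ?S = "(\<lambda>\<sigma>. prod_encode (e \<sigma>, mat_code (mp_mat B \<sigma>))) ` \<Sigma>"
    from assms Some Letter have "\<sigma> \<in> \<Sigma>" by (auto simp: instructions_def)
    have "zmax_code (mp_mat B \<sigma> $ i $ j) \<le> mat_code (mp_mat B \<sigma>)"
      by (rule order_trans[OF zmax_code_le_vec_code vec_code_le_mat_code])
    also have "\<dots> \<le> prod_encode (e \<sigma>, mat_code (mp_mat B \<sigma>))"
      by (rule le_prod_encode_2)
    also have "\<dots> \<le> set_encode ?S"
      using \<open>\<sigma> \<in> \<Sigma>\<close> finite_alphabet by (intro less_imp_le less_set_encode) auto
    also have "\<dots> \<le> n"
      unfolding n_def automaton_code_def by (rule le_list_encode) simp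
    finally show ?thesis using Some Letter by simp
  qed
qed

lemma entries_le_mc: "rd \<in> instructions \<Sigma> \<Longrightarrow> entries_le n (mc rd)"
  unfolding mc_def by (intro entries_le_mat_code entries_bound)

lemma internally_terminating_T: "internally_terminating T"
  unfolding internally_terminating_def
proof (intro exI ballI impI)
  \<comment> \<open>A gadget is left with at most \<open>2 * cap n\<close> increments to do; as
    \<open>j \<le> cap n\<close> inside it, its ranks stay above that.\<close>
  let ?rank = "\<lambda>p. if pfst (psnd p) = 0 then psnd (psnd p) else 3 * cap n + 1 - psnd (psnd p)"
  fix t
  assume "t \<in> transitions T" "reads t = None"
  then show "?rank (target t) < ?rank (source t) \<or> target t = source t \<and> action t = Dec"
  proof (cases rule: transition_cases)
    case (out rd q j)
    have "nf_diff (res1 n (mc rd) q j) (res2 n (mc rd) q j) \<le> 2 * cap n"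
      by (intro nf_diff_le res_le entries_le_mc out)
    with out show ?thesis by (simp add: out_tr_def state_def)
  next
    case (dec rd q j)
    then show ?thesis by (cases "j = cap n") (auto simp: dec_tr_def state_def)
  qed (simp_all add: inc_tr_def read_tr_def state_def)
qed

lemma one_counter_transducer_T: "one_counter_transducer \<Sigma> T"
proof -
  have st: "states T = {..<Suc (set_encode (transition_code e ` transitions T))} \<union> {state 0 1 0, state 0 0 0}"
    by (simp add: T_def simulator_def Let_def)
  have "source t \<in> states T \<and> target t \<in> states T" if "t \<in> transitions T" for t
  proof -
    have "transition_code e t < set_encode (transition_code e ` transitions T)"
      using that finite_transitions by (intro less_set_encode) auto
    moreover have "source t \<le> transition_code e t" "target t \<le> transition_code e t"
      unfolding transition_code_def by (rule le_list_encode; simp)+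
    ultimately show ?thesis by (simp add: st)
  qed
  moreover have "\<sigma> \<in> \<Sigma>" if "t \<in> transitions T" "reads t = Some (Letter \<sigma>)" for t \<sigma>
    using that by (cases rule: transition_cases)
      (auto simp: inc_tr_def read_tr_def out_tr_def dec_tr_def instructions_def)
  moreover have "start T \<in> states T" "accepting T \<subseteq> states T" "finite (states T)"
    unfolding st by (auto simp: T_def simulator_def Let_def)
  ultimately show ?thesis
    using finite_transitions by (auto simp: one_counter_transducer_def)
qed

section \<open>Correctness of a single routine\<close>

lemma counter_fill:
  assumes "q < 4" "m \<le> 2 * cap n"
  shows "\<exists>ts. computation T (state q 0 m, k, u) ts (state q 0 0, k + m, u) \<and> emission ts = 0"
  using assms(2)
proof (induction m arbitrary: k)
  case 0
  show ?case by (intro exI[of _ "[]"]) (simp add: computation_Nil)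
next
  case (Suc m)
  then obtain ts where "computation T (state q 0 m, Suc k, u) ts (state q 0 0, Suc k + m, u)"
    "emission ts = 0" by fastforce
  moreover have "inc_tr q m \<in> transitions T"
    using assms(1) Suc.prems Suc_le_lessD unfolding in_transitions_iff by blast
  ultimately show ?case
    by (intro exI[of _ "inc_tr q m # ts"]) (auto simp: computation_Cons_iff inc_tr_def)
qed

text \<open>Here \<open>x\<close> and \<open>y\<close> are the offset forms of the vector to be
  produced. \<open>rep\<close> ignores the counter for \<open>q < 2\<close>, so its emptiness is
  demanded separately.\<close>

definition settles :: "'a config \<Rightarrow> 'a symbol list \<Rightarrow> nat \<Rightarrow> nat \<Rightarrow> bool" where
  "settles c u x y \<longleftrightarrow>
     (if x = 0 \<and> y = 0
      then \<exists>ts c'. computation T c ts c' \<and> terminal T c' \<and> fst c' \<noteq> state 0 0 0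
      else \<exists>ts q m. computation T c ts (state q 0 0, m, u) \<and> q < 4 \<and> (q < 2 \<longrightarrow> m = 0) \<and>
        (\<forall>s. rep q m (s + emission ts) = zvec (val n s x) (val n s y)))"

text \<open>\<open>settles\<close> holds for every prior amount \<open>s\<close>; taking
  \<open>s + g\<close> turns an earlier emission \<open>g\<close> into a shift of both
  coordinates.\<close>

lemma settles_step:
  assumes "t \<in> transitions T" "enabled t c" "emits t = int g" "settles (fire t c) u x y"
  shows "settles c u (shift x g) (shift y g)"
proof (cases "x = 0 \<and> y = 0")
  case True
  with assms(4) obtain ts c' where "computation T (fire t c) ts c'" "terminal T c'"
    "fst c' \<noteq> state 0 0 0" by (auto simp: settles_def)
  with assms(1,2) True show ?thesis
    unfolding settles_def
    by (auto simp: computation_Cons_iff simp del: split_paired_Ex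
        intro!: exI[of _ "t # ts"] exI[of _ c'])
next
  case False
  with assms(4) obtain ts q m where "computation T (fire t c) ts (state q 0 0, m, u)"
    "q < 4" "q < 2 \<longrightarrow> m = 0"
    "\<And>s. rep q m (s + emission ts) = zvec (val n s x) (val n s y)"
    by (auto simp: settles_def)
  moreover from this(4)[of "_ + int g"] have
    "rep q m (s + emission (t # ts)) =
      zvec (val n s (shift x g)) (val n s (shift y g))" for s
    by (simp add: assms(3) val_shift add.assoc)
  ultimately show ?thesis
    unfolding settles_def using assms(1,2) False
    by (subst if_not_P)
      (simp, intro exI[of _ "t # ts"] exI[of _ q] exI[of _ m], simp add: computation_Cons_iff)
qed

text \<open>Serves both exits, the zero test with \<open>k = 0\<close> and the exit at the cap with
  \<open>k\<close> left in the counter. Hence the result \<open>x\<close>, \<open>y\<close> is kept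
  apart from the hard-wired \<open>a\<close>, \<open>b\<close>.\<close>

lemma settles_out:
  assumes "rd \<in> instructions \<Sigma>" "q < 4" "j \<le> cap n"
  defines "a \<equiv> res1 n (mc rd) q j" and "b \<equiv> res2 n (mc rd) q j"
  assumes "a \<noteq> 0 \<or> b \<noteq> 0" "k = 0 \<or> j = cap n \<and> keep n (mc rd) q" "x \<noteq> 0 \<or> y \<noteq> 0"
    and "nf_type a b < 2 \<longrightarrow> k = 0"
    and "\<And>s. rep (nf_type a b) (nf_diff a b + k) (s + nf_emit n a b) =
      zvec (val n s x) (val n s y)"
  shows "settles (state q (rc rd) j, k, u) u x y"
proof -
  let ?t = "out_tr n (mc rd) (rc rd) q j :: 'a transition"
  have "0 < max (res1 n (mc rd) q j) (res2 n (mc rd) q j)"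
    using assms(6) by (auto simp: a_def b_def)
  with assms(1-3) have t: "?t \<in> transitions T"
    unfolding in_transitions_iff by blast
  have "nf_diff a b \<le> 2 * cap n"
    unfolding a_def b_def by (intro nf_diff_le res_le entries_le_mc assms)
  from counter_fill[OF nf_type_less this]
  obtain ts where "computation T (state (nf_type a b) 0 (nf_diff a b), k, u) ts
      (state (nf_type a b) 0 0, k + nf_diff a b, u)" "emission ts = 0" by blast
  with t assms(7) have "computation T (state q (rc rd) j, k, u) (?t # ts)
      (state (nf_type a b) 0 0, k + nf_diff a b, u)" "emission (?t # ts) = nf_emit n a b"
    by (auto simp: computation_Cons_iff out_tr_def a_def[symmetric] b_def[symmetric])
  moreover have "nf_type a b < 2 \<longrightarrow> k + nf_diff a b = 0"
    using assms(9) by (auto simp: nf_diff_def nf_type_def split: if_splits)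
  ultimately show ?thesis
    using assms(8,10) nf_type_less
    unfolding settles_def by (auto simp: add.commute intro!: exI)
qed

text \<open>Below the cap a decrement moves one unit from the counter into the control and preserves
  \<open>j + k\<close>. At the cap it lowers \<open>j + k\<close>, and \<open>res_beyond_cap\<close>
  shows that emitting the gain compensates for this.\<close>

lemma gadget_settles:
  assumes "rd \<in> instructions \<Sigma>" "q < 4" "j \<le> cap n"
  shows "settles (state q (rc rd) j, k, u) u (res1 n (mc rd) q (j + k)) (res2 n (mc rd) q (j + k))"
  using assms(3)
proof (induction k arbitrary: j)
  case 0
  let ?x = "res1 n (mc rd) q j" and ?y = "res2 n (mc rd) q j"
  show ?case
  proof (cases "?x = 0 \<and> ?y = 0")
    case True
    \<comment> \<open>With an empty counter \<open>Dec\<close> blocks, and there is no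
      \<open>out_tr\<close> for a result without finite coordinate.\<close>
    have "terminal T (state q (rc rd) j, 0, u)"
      unfolding terminal_def
    proof
      fix t
      assume "t \<in> transitions T"
      then show "\<not> enabled t (state q (rc rd) j, 0, u)"
        by (cases rule: transition_cases)
          (use assms(1) True in \<open>auto simp: inc_tr_def read_tr_def out_tr_def dec_tr_def rc_eq_iff\<close>)
    qed
    with True show ?thesis
      unfolding settles_def
      by (auto simp del: split_paired_Ex
          intro!: exI[of _ "[]"] exI[of _ "(state q (rc rd) j, 0, u)"] computation_Nil)
  next
    case False
    then show ?thesis
      using assms(1,2) 0 by (intro settles_out) (simp_all add: rep_nf)
  qed
next
  case (Suc k)
  note le = entries_le_mc[OF assms(1)]
  show ?case
  proof (cases "j = cap n \<and> keep n (mc rd) q")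
    case True
    then have j: "j = cap n" and keep: "keep n (mc rd) q" by auto
    note rk = rep_keep[OF le keep]
    have "res1 n (mc rd) q (cap n + Suc k) \<noteq> 0"
      using rk(1) by (auto simp: res1_def max_def shift_def split: if_splits)
    then show ?thesis
      unfolding j using assms(1,2) keep rk
      by (intro settles_out) (auto simp: nf_type_def simp del: add_Suc_right)
  next
    case False
    let ?t = "dec_tr n (mc rd) (rc rd) q j :: 'a transition"
    let ?c = "(state q (rc rd) j, Suc k, u) :: 'a config"
    have t: "?t \<in> transitions T"
      using assms(1,2) Suc.prems False unfolding in_transitions_iff by blast
    have en: "enabled ?t ?c" by (simp add: dec_tr_def)
    have fire: "fire ?t ?c = (state q (rc rd) (min (Suc j) (cap n)), k, u)"
      by (simp add: dec_tr_def)
    note IH = Suc.IH[of "min (Suc j) (cap n)"]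
    show ?thesis
    proof (cases "j = cap n")
      case True
      then have "emits ?t = int (gain (mc rd) q)" by (simp add: dec_tr_def)
      from settles_step[OF t en this] fire IH True False show ?thesis
        by (simp add: res_beyond_cap[OF le] del: add_Suc_right)
    next
      case False
      then have "emits ?t = int 0" by (simp add: dec_tr_def)
      from settles_step[OF t en this] fire IH False Suc.prems show ?thesis
        by (simp add: min_def)
    qed
  qed
qed

lemma gadget_run:
  fixes k :: nat and s :: int
  assumes "rd \<in> instructions \<Sigma>" "q < 4"
  defines "v \<equiv> rep q k s v* instruction_mat B rd"
  obtains (stuck) ts c' where "v = 0" "computation T (state q (rc rd) 0, k, u) ts c'"
      "terminal T c'" "fst c' \<noteq> state 0 0 0"
  | (run) ts q' m where "computation T (state q (rc rd) 0, k, u) ts (state q' 0 0, m, u)"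
      "q' < 4" "q' < 2 \<longrightarrow> m = 0" "rep q' m (s + emission ts) = v"
proof -
  let ?x = "res1 n (mc rd) q k" and ?y = "res2 n (mc rd) q k"
  have settles: "settles (state q (rc rd) 0, k, u) u ?x ?y"
    using gadget_settles[OF assms(1,2), of 0] by simp
  have v: "v = zvec (val n s ?x) (val n s ?y)"
    unfolding v_def mc_def zmax_vec_eq_iff
    using rep_mult[OF assms(2) entries_bound[OF assms(1)]] by simp
  show ?thesis
  proof (cases "?x = 0 \<and> ?y = 0")
    case True
    with v have "v = 0" by (simp add: zmax_vec_eq_iff zero_zmax_def)
    with settles True stuck show ?thesis by (auto simp: settles_def)
  next
    case False
    with settles v run show ?thesis by (auto simp: settles_def)
  qed
qed

section \<open>Correctness on whole words\<close>

definition resolves :: "'a config \<Rightarrow> int \<Rightarrow> zmax \<Rightarrow> bool" where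
  "resolves c s z \<longleftrightarrow> (\<exists>ts c'. computation T c ts c' \<and> terminal T c' \<and>
     (if z = NegInf then fst c' \<noteq> state 0 0 0
      else c' = (state 0 0 0, 0, []) \<and> z = Fin (s + emission ts)))"

lemma resolves_prepend:
  assumes "computation T c ts c'" "resolves c' (s + emission ts) z"
  shows "resolves c s z"
proof -
  from assms(2) obtain us c'' where us: "computation T c' us c''" "terminal T c''"
    "if z = NegInf then fst c'' \<noteq> state 0 0 0
     else c'' = (state 0 0 0, 0, []) \<and> z = Fin (s + emission ts + emission us)"
    unfolding resolves_def by blast
  with computation_append[OF assms(1) us(1)] show ?thesis
    unfolding resolves_def
    by (intro exI[of _ "ts @ us"] exI[of _ c'']) (auto simp: add.assoc split: if_splits)
qed

lemma resolves_read:
  assumes "Some a \<in> instructions \<Sigma>" "q < 4"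
    and "resolves (state q (rc (Some a)) 0, k, u) s z"
  shows "resolves (state q 0 0, k, a # u) s z"
proof (rule resolves_prepend)
  let ?t = "read_tr (rc (Some a)) (Some a) q"
  have "?t \<in> transitions T"
    using assms(1,2) unfolding in_transitions_iff by blast
  then have "computation T (state q 0 0, k, a # u) [?t] (fire ?t (state q 0 0, k, a # u))"
    by (rule computation_single) (simp add: read_tr_def)
  then show "computation T (state q 0 0, k, a # u) [?t] (state q (rc (Some a)) 0, k, u)"
    by (simp add: read_tr_def)
  show "resolves (state q (rc (Some a)) 0, k, u) (s + emission [?t]) z"
    using assms(3) by (simp add: read_tr_def)
qed

definition weight_from :: "zmax ^ 2 \<Rightarrow> 'a list \<Rightarrow> zmax" where
  "weight_from v w = (\<Sum>i\<in>UNIV. foldl (\<lambda>v \<sigma>. v v* mp_mat B \<sigma>) v w $ i * mp_final B $ i)"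

lemma weight_from_Cons: "weight_from v (\<sigma> # w) = weight_from (v v* mp_mat B \<sigma>) w"
  by (simp add: weight_from_def)

text \<open>Justifies getting stuck before the input is exhausted: a vector without finite
  coordinate never recovers.\<close>

lemma weight_from_0: "weight_from 0 w = NegInf"
proof -
  have "foldl (\<lambda>v \<sigma>. v v* mp_mat B \<sigma>) 0 w = 0"
    by (induction w) (auto simp: vec_eq_iff vector_matrix_mult_nth_2)
  then show ?thesis by (simp add: weight_from_def zero_zmax_def)
qed

lemma resolves_stuck:
  "computation T c ts c' \<Longrightarrow> terminal T c' \<Longrightarrow> fst c' \<noteq> state 0 0 0 \<Longrightarrow> resolves c s NegInf"
  unfolding resolves_def by (auto simp del: split_paired_Ex)

lemma resolves_hub:
  assumes "set w \<subseteq> \<Sigma>" "q < 4" "q < 2 \<longrightarrow> k = 0"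
  shows "resolves (state q 0 0, k, map Letter w @ [EndMarker]) s (weight_from (rep q k s) w)"
  using assms
proof (induction w arbitrary: q k s)
  case Nil
  have rd: "Some EndMarker \<in> instructions \<Sigma>" by (simp add: instructions_def)
  let ?v = "rep q k s v* instruction_mat B (Some EndMarker)"
  have v: "?v $ 1 = weight_from (rep q k s) []" "?v $ 2 = NegInf"
    by (simp_all add: vector_matrix_mult_nth_2 weight_from_def sum_2 flip: zero_zmax_def)
  have "resolves (state q (rc (Some EndMarker)) 0, k, []) s (?v $ 1)"
    using rd \<open>q < 4\<close>
  proof (cases rule: gadget_run[where k = k and s = s and u = "[]"])
    case (stuck ts c')
    then show ?thesis by (auto simp: zero_zmax_def intro: resolves_stuck)
  next
    case (run ts q' m)
    from v(2) have "rep q' m (s + emission ts) $ 2 = NegInf" by (simp only: run(4))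
    \<comment> \<open>Only kind \<open>0\<close> has second coordinate \<open>NegInf\<close>, so the
      end marker leads to the accepting state.\<close>
    then have q': "q' = 0" by (auto simp: rep_def split: if_splits)
    moreover have "rep q' m (s + emission ts) $ 1 = ?v $ 1" by (simp only: run(4))
    ultimately have "m = 0" "?v $ 1 = Fin (s + emission ts)"
      using run(3) by (auto simp: rep_def)
    moreover have "terminal T (state 0 0 0, 0, [])"
      unfolding terminal_def
    proof
      fix t
      assume "t \<in> transitions T"
      then show "\<not> enabled t (state 0 0 0, 0, [])"
        by (cases rule: transition_cases)
          (auto simp: inc_tr_def read_tr_def out_tr_def dec_tr_def split: option.splits)
    qed
    ultimately show ?thesis
      using run(1) q' unfolding resolves_def by auto
  qed
  with resolves_read[OF rd Nil(2)] v(1) show ?case by simp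
next
  case (Cons \<sigma> w)
  have rd: "Some (Letter \<sigma>) \<in> instructions \<Sigma>" using Cons.prems by (simp add: instructions_def)
  let ?u = "map Letter w @ [EndMarker]"
  let ?v = "rep q k s v* instruction_mat B (Some (Letter \<sigma>))"
  have "resolves (state q (rc (Some (Letter \<sigma>))) 0, k, ?u) s (weight_from ?v w)"
    using rd \<open>q < 4\<close>
  proof (cases rule: gadget_run[where k = k and s = s and u = ?u])
    case (stuck ts c')
    then show ?thesis by (auto simp: weight_from_0 intro: resolves_stuck)
  next
    case (run ts q' m)
    with Cons.IH[of q' m "s + emission ts"] Cons.prems show ?thesis
      by (intro resolves_prepend[OF run(1)]) simp
  qed
  with resolves_read[OF rd Cons.prems(2)] show ?case by (simp add: weight_from_Cons)
qed

lemma resolves_start: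
  assumes "w \<in> lists \<Sigma>"
  shows "resolves (start_config T w) 0 (mp_weight B w)"
proof -
  have rd: "None \<in> instructions \<Sigma>" by (simp add: instructions_def)
  let ?u = "map Letter w @ [EndMarker]"
  let ?v = "rep 0 0 0 v* instruction_mat B None"
  \<comment> \<open>\<open>rep 0 0 0\<close> is the first unit vector of the semiring, so the
    product picks out the first row.\<close>
  have "Fin 0 = 1" by (simp add: one_zmax_def)
  then have "?v = mp_init B"
    by (simp add: vec_eq_iff vector_matrix_mult_nth_2 rep_def flip: zero_zmax_def)
  then have v: "weight_from ?v w = mp_weight B w"
    by (simp add: weight_from_def mp_weight_def)
  have "start_config T w = (state 0 (rc None) 0, 0, ?u)"
    by (simp add: start_config_def T_def simulator_def Let_def rc_def)
  moreover have "resolves (state 0 (rc None) 0, 0, ?u) 0 (weight_from ?v w)"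
    using rd zero_less_numeral
  proof (cases rule: gadget_run[where k = 0 and s = 0 and u = ?u])
    case (stuck ts c')
    then show ?thesis by (auto simp: weight_from_0 intro: resolves_stuck)
  next
    case (run ts q' m)
    with resolves_hub[of w q' m "emission ts"] assms show ?thesis
      by (intro resolves_prepend[OF run(1)]) auto
  qed
  ultimately show ?thesis by (simp only: v)
qed

text \<open>In the accepting state with no input left nothing is enabled. A successful computation
  is therefore a terminal one and coincides with the run from \<open>resolves_start\<close>.\<close>

lemma correct:
  assumes "w \<in> lists \<Sigma>"
  shows "mp_weight B w = NegInf \<Longrightarrow> \<not> (\<exists>ts. successful T w ts)"
    and "mp_weight B w \<noteq> NegInf \<Longrightarrow> (\<exists>ts. successful T w ts) \<and>
      (\<forall>ts. successful T w ts \<longrightarrow> Fin (emission ts) = mp_weight B w)"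
proof -
  have acc: "accepting T = {state 0 0 0}" by (simp add: T_def simulator_def Let_def)
  from resolves_start[OF assms] obtain ts c' where ts:
    "computation T (start_config T w) ts c'" "terminal T c'"
    "if mp_weight B w = NegInf then fst c' \<noteq> state 0 0 0
      else c' = (state 0 0 0, 0, []) \<and> mp_weight B w = Fin (0 + emission ts)"
    unfolding resolves_def by blast
  have final: "us = ts \<and> fst c' = state 0 0 0" if "successful T w us" for us
  proof -
    from that acc obtain k where us: "computation T (start_config T w) us (state 0 0 0, k, [])"
      by (auto simp: successful_def)
    have "terminal T (state 0 0 0, k, [])"
      unfolding terminal_def
    proof
      fix t
      assume "t \<in> transitions T"
      then show "\<not> enabled t (state 0 0 0, k, [])"
        by (cases rule: transition_cases)
          (auto simp: inc_tr_def read_tr_def out_tr_def dec_tr_def split: option.splits)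
    qed
    from terminal_computation_unique[OF conflict_free_T ts(1,2) us this] show ?thesis by auto
  qed
  show "\<not> (\<exists>ts. successful T w ts)" if "mp_weight B w = NegInf"
    using final ts(3) that by auto
  show "(\<exists>ts. successful T w ts) \<and>
      (\<forall>ts. successful T w ts \<longrightarrow> Fin (emission ts) = mp_weight B w)" if "mp_weight B w \<noteq> NegInf"
    using final ts that acc by (auto simp: successful_def)
qed

end

section \<open>Computability of the construction\<close>

lemma computable_list_encode_Nil [computable_intros]: "computable (\<lambda>x. list_encode [])"
  by (rule computable_const)

lemma computable_list_encode_Cons [computable_intros]:
  assumes "computable f" "computable (\<lambda>x. list_encode (xs x))"
  shows "computable (\<lambda>x. list_encode (f x # xs x))"
  unfolding list_encode.simps using assms by (intro computable_intros)

lemma computable_lhd [computable_intros]: "computable f \<Longrightarrow> computable (\<lambda>x. lhd (f x))"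
  unfolding lhd_def by (intro computable_intros)

lemma computable_ltl [computable_intros]: "computable f \<Longrightarrow> computable (\<lambda>x. ltl (f x))"
  unfolding ltl_def by (intro computable_intros)

lemma computable_zoff [computable_intros]:
  "computable n \<Longrightarrow> computable z \<Longrightarrow> computable (\<lambda>x. zoff (n x) (z x))"
  unfolding zoff_def by (intro computable_intros) simp_all

lemma computable_shift [computable_intros]:
  "computable z \<Longrightarrow> computable k \<Longrightarrow> computable (\<lambda>x. shift (z x) (k x))"
  unfolding shift_def by (intro computable_intros)

lemma computable_base_row [computable_intros]:
  "computable q \<Longrightarrow> computable M \<Longrightarrow> computable (\<lambda>x. base_row (q x) (M x))"
  unfolding base_row_def by (intro computable_intros)

lemma computable_other_row [computable_intros]:
  "computable q \<Longrightarrow> computable M \<Longrightarrow> computable (\<lambda>x. other_row (q x) (M x))"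
  unfolding other_row_def by (intro computable_intros)

lemma computable_res1 [computable_intros]:
  "computable n \<Longrightarrow> computable M \<Longrightarrow> computable q \<Longrightarrow> computable k \<Longrightarrow>
    computable (\<lambda>x. res1 (n x) (M x) (q x) (k x))"
  unfolding res1_def by (intro computable_intros)

lemma computable_res2 [computable_intros]:
  "computable n \<Longrightarrow> computable M \<Longrightarrow> computable q \<Longrightarrow> computable k \<Longrightarrow>
    computable (\<lambda>x. res2 (n x) (M x) (q x) (k x))"
  unfolding res2_def by (intro computable_intros)

lemma computable_nf_type [computable_intros]:
  "computable f \<Longrightarrow> computable g \<Longrightarrow> computable (\<lambda>x. nf_type (f x) (g x))"
  unfolding nf_type_def by (intro computable_intros)

lemma computable_nf_diff [computable_intros]:
  "computable f \<Longrightarrow> computable g \<Longrightarrow> computable (\<lambda>x. nf_diff (f x) (g x))"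
  unfolding nf_diff_def by (intro computable_intros)

lemma computable_nf_base [computable_intros]:
  "computable f \<Longrightarrow> computable g \<Longrightarrow> computable (\<lambda>x. nf_base (f x) (g x))"
  unfolding nf_base_def by (intro computable_intros)

text \<open>Brings a signed emission within reach of the closure rules, which concern natural
  numbers: \<open>k\<close> is coded as \<open>2 * k\<close> if nonnegative and as
  \<open>-2 * k - 1\<close> otherwise.\<close>

lemma int_encode_nf_emit:
  "int_encode (nf_emit n x y) =
     (if Suc n \<le> nf_base x y then 2 * (nf_base x y - Suc n) else 2 * (Suc n - nf_base x y) - 1)"
  by (auto simp: nf_emit_def int_encode_def sum_encode_def)

lemma computable_nf_emit [computable_intros]:
  "computable n \<Longrightarrow> computable f \<Longrightarrow> computable g \<Longrightarrow>
    computable (\<lambda>x. int_encode (nf_emit (n x) (f x) (g x)))"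
  unfolding int_encode_nf_emit by (intro computable_intros)

lemma computable_state [computable_intros]:
  "computable q \<Longrightarrow> computable r \<Longrightarrow> computable j \<Longrightarrow> computable (\<lambda>x. state (q x) (r x) (j x))"
  unfolding state_def by (intro computable_intros)

lemma computable_cap [computable_intros]: "computable f \<Longrightarrow> computable (\<lambda>x. cap (f x))"
  unfolding cap_def by (intro computable_intros)

lemma decidable_keep [computable_intros]:
  "computable n \<Longrightarrow> computable M \<Longrightarrow> computable q \<Longrightarrow> decidable (\<lambda>x. keep (n x) (M x) (q x))"
  unfolding keep_def by (intro computable_intros)

lemma computable_gain [computable_intros]:
  "computable M \<Longrightarrow> computable q \<Longrightarrow> computable (\<lambda>x. gain (M x) (q x))"
  unfolding gain_def by (intro computable_intros)

section \<open>Transitions and instructions at the level of codes\<close>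

definition inc_code :: "nat \<Rightarrow> nat \<Rightarrow> nat" where
  "inc_code q m = list_encode [state q 0 (Suc m), 0, 1, 0, state q 0 m]"

definition read_code :: "nat \<Rightarrow> nat \<Rightarrow> nat" where
  "read_code rc q = list_encode [state q 0 0, rc, 0, 0, state q (Suc rc) 0]"

definition out_code :: "nat \<Rightarrow> nat \<Rightarrow> nat \<Rightarrow> nat \<Rightarrow> nat \<Rightarrow> nat" where
  "out_code n M r q j = list_encode
     [state q r j, 0, if j = cap n \<and> keep n M q then 0 else 3,
      int_encode (nf_emit n (res1 n M q j) (res2 n M q j)),
      state (nf_type (res1 n M q j) (res2 n M q j)) 0 (nf_diff (res1 n M q j) (res2 n M q j))]"

definition dec_code :: "nat \<Rightarrow> nat \<Rightarrow> nat \<Rightarrow> nat \<Rightarrow> nat \<Rightarrow> nat" where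
  "dec_code n M r q j = list_encode
     [state q r j, 0, 2, if j = cap n then 2 * gain M q else 0, state q r (min (Suc j) (cap n))]"

lemma transition_code_simps:
  "transition_code e (inc_tr q m) = inc_code q m"
  "transition_code e (read_tr (Suc (reads_code e rd)) rd q) = read_code (reads_code e rd) q"
  "transition_code e (out_tr n M r q j) = out_code n M r q j"
  "transition_code e (dec_tr n M r q j) = dec_code n M r q j"
  by (simp_all add: transition_code_def inc_tr_def inc_code_def read_tr_def read_code_def
      out_tr_def out_code_def dec_tr_def dec_code_def int_encode_def sum_encode_def
      del: list_encode.simps)

definition gadget_codes :: "nat \<Rightarrow> nat \<Rightarrow> nat \<Rightarrow> nat \<Rightarrow> nat set" where
  "gadget_codes n M rc q =
     (if rc = 0 then {} else {read_code rc q}) \<union>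
     (\<Union>j\<in>{..<Suc (cap n)}. if 0 < max (res1 n M q j) (res2 n M q j)
        then {out_code n M (Suc rc) q j} else {}) \<union>
     (\<Union>j\<in>{..<Suc (cap n)}. if j = cap n \<and> keep n M q then {} else {dec_code n M (Suc rc) q j})"

text \<open>Pairs of a \<open>reads_code\<close> and a matrix code, read off the automaton code: the
  initial vector as both rows, the final vector as first column with \<open>0\<close> for
  \<open>NegInf\<close>, and the letters renumbered by \<open>+ 2\<close> as in
  \<open>reads_code\<close>.\<close>

definition instruction_codes :: "nat \<Rightarrow> nat set" where
  "instruction_codes n =
     {prod_encode (0, list_encode [lhd n, lhd n])} \<union>
     {prod_encode (1, list_encode [list_encode [lhd (lhd (ltl (ltl n))), 0],
        list_encode [lhd (ltl (lhd (ltl (ltl n)))), 0]])} \<union>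
     (\<Union>l\<in>set_decode (lhd (ltl n)). {prod_encode (pfst l + 2, psnd l)})"

definition simulator_codes :: "nat \<Rightarrow> nat set" where
  "simulator_codes n =
     (\<Union>q\<in>{..<4}. \<Union>m\<in>{..<2 * cap n}. {inc_code q m}) \<union>
     (\<Union>i\<in>instruction_codes n. \<Union>q\<in>{..<4}. gadget_codes n (psnd i) (pfst i) q)"

lemma reads_code_eq_0_iff: "reads_code e rd = 0 \<longleftrightarrow> rd = None"
  by (cases "(e, rd)" rule: reads_code.cases) auto

lemma transition_code_gadget:
  "transition_code e ` gadget n M (Suc (reads_code e rd)) rd q =
    gadget_codes n M (reads_code e rd) q"
  unfolding gadget_def gadget_codes_def
  by (auto simp: image_Un image_UN transition_code_simps reads_code_eq_0_iff if_distrib[of "image _"]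
      cong: if_cong)

lemma instruction_codes_automaton_code:
  assumes "finite \<Sigma>"
  shows "instruction_codes (automaton_code \<Sigma> e B) =
    (\<lambda>rd. prod_encode (reads_code e rd, mat_code (instruction_mat B rd))) ` instructions \<Sigma>"
proof -
  have "mat_code (\<chi> i. v) = list_encode [vec_code v, vec_code v]" for v
    by (simp add: mat_code_def)
  moreover have "mat_code (\<chi> i j. if j = 1 then v $ i else NegInf) =
      list_encode [list_encode [zmax_code (v $ 1), 0], list_encode [zmax_code (v $ 2), 0]]" for v
    by (simp add: mat_code_def vec_code_def)
  ultimately show ?thesis
    using assms unfolding instruction_codes_def automaton_code_def instructions_def
    by (auto simp: vec_code_def image_image)
qed

lemma transition_code_simulator:
  assumes "finite \<Sigma>"
  shows "transition_code e ` simulator_transitions \<Sigma> e B (automaton_code \<Sigma> e B) =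
    simulator_codes (automaton_code \<Sigma> e B)"
  unfolding simulator_transitions_def simulator_codes_def instruction_codes_automaton_code[OF assms]
  by (simp add: image_Un image_UN transition_code_simps transition_code_gadget)

lemma computable_set_simulator_codes: "computable_set simulator_codes"
  unfolding simulator_codes_def instruction_codes_def gadget_codes_def inc_code_def read_code_def
    out_code_def dec_code_def
  by (intro computable_intros)

text \<open>The two extra states form a union of singletons to match the closure rules.\<close>

definition construct :: "nat \<Rightarrow> nat" where
  "construct n = list_encode
     [set_encode ({..<Suc (set_encode (simulator_codes n))} \<union> ({state 0 1 0} \<union> {state 0 0 0})),
      state 0 1 0, set_encode {state 0 0 0}, set_encode (simulator_codes n)]"

lemma computable_construct: "computable construct"
  unfolding construct_def
  by (intro computable_intros computable_setD(2) computable_setD(2)[OF computable_set_simulator_codes])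

lemma construct_automaton_code:
  "finite \<Sigma> \<Longrightarrow> construct (automaton_code \<Sigma> e B) = transducer_code e (simulator \<Sigma> e B)"
  unfolding construct_def transducer_code_def simulator_def Let_def
  by (simp add: transition_code_simulator insert_is_Un[symmetric] insert_commute del: list_encode.simps)

theorem lemma4p1:
  "\<exists>construct :: nat \<Rightarrow> nat. computable construct \<and>
     (\<forall>(\<Sigma> :: 'a set) (e :: 'a \<Rightarrow> nat) (B :: 'a mp_automaton).
        finite \<Sigma> \<and> inj_on e \<Sigma> \<longrightarrow>
        (\<exists>T :: 'a transducer.
           one_counter_transducer \<Sigma> T \<and>
           construct (automaton_code \<Sigma> e B) = transducer_code e T \<and>
           (\<forall>w\<in>lists \<Sigma>.
              (mp_weight B w = NegInf \<longrightarrow> \<not> (\<exists>ts. successful T w ts)) \<and>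
              (mp_weight B w \<noteq> NegInf \<longrightarrow>
                 (\<exists>ts. successful T w ts) \<and>
                 (\<forall>ts. successful T w ts \<longrightarrow> Fin (emission ts) = mp_weight B w))) \<and>
           deterministic \<Sigma> T \<and>
           unique_finite_routines \<Sigma> T))"
proof (intro exI[of _ construct] conjI allI impI)
  show "computable construct" by (rule computable_construct)
  fix \<Sigma> :: "'a set" and e :: "'a \<Rightarrow> nat" and B :: "'a mp_automaton"
  assume asm: "finite \<Sigma> \<and> inj_on e \<Sigma>"
  then interpret simulation \<Sigma> e B by unfold_locales auto
  note [intro] = deterministic_if_conflict_free[OF conflict_free_T]
    unique_finite_routines_if_internally_terminating[OF conflict_free_T internally_terminating_T]
  show "\<exists>T. one_counter_transducer \<Sigma> T \<and>
      construct (automaton_code \<Sigma> e B) = transducer_code e T \<and>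
      (\<forall>w\<in>lists \<Sigma>.
         (mp_weight B w = NegInf \<longrightarrow> \<not> (\<exists>ts. successful T w ts)) \<and>
         (mp_weight B w \<noteq> NegInf \<longrightarrow>
            (\<exists>ts. successful T w ts) \<and>
            (\<forall>ts. successful T w ts \<longrightarrow> Fin (emission ts) = mp_weight B w))) \<and>
      deterministic \<Sigma> T \<and> unique_finite_routines \<Sigma> T"
    using one_counter_transducer_T construct_automaton_code[OF finite_alphabet, of e B] correct
    by (intro exI[of _ T]) (auto simp: T_def[symmetric])
qed

end
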